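(* Let $\varepsilon>0$ and let $p\in[0,1]^{\mathbb{N}}$ satisfy $p(n)\geq n^{-\frac12+\varepsilon}$ for all $n$. Then, as $n\to\infty$, a random graph $G\sim G_{n,p}$ asymptotically almost surely has the following properties: (1) the $\mathbb{F}_2$-span of (the edge-sets of) all circuits of length $n$ or $n-1$ in $G$ equals $\mathrm{Z}_1(G;\mathbb{F}_2)$; (2) if $n$ is even, then $\dim_{\mathbb{F}_2}\left(\mathrm{Z}_1(G;\mathbb{F}_2)/\langle\mathcal{H}(G)\rangle_{\mathbb{F}_2}\right)=1$; (3) if $n$ is odd, then $\langle\mathcal{H}(G)\rangle_{\mathbb{F}_2}=\mathrm{Z}_1(G;\mathbb{F}_2)$.
   Context: $G_{n,p}$ denotes the binomial random graph on the vertex set $\{1,\dots,n\}$ in which each of the $\binom n2$ possible edges is present independently with probability $p=p(n)$; "asymptotically almost surely" (a.a.s.) means with probability tending to $1$ as $n\to\infty$. A "circuit" is a $2$-regular connected graph (a cycle subgraph); its length is its number of edges. $\mathrm{Z}_1(G;\mathbb{F}_2)$ is the cycle space of $G$, i.e. the subspace of the edge space $\mathbb{F}_2^{E(G)}$ consisting of edge sets in which every vertex has even degree (equivalently, spanned by the edge sets of circuits); its elements are called cycles. $\mathcal{H}(G)$ is the set of all Hamilton circuits of $G$ (circuits containing all vertices), and $\langle\mathcal{H}(G)\rangle_{\mathbb{F}_2}$ is the $\mathbb{F}_2$-span of their edge sets (viewed as vectors in the edge space). *)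

theory Defs
  imports
    "HOL-Probability.Product_PMF"
    "HOL-Library.Z2"
    "HOL-Algebra.AbelCoset"
    "Jordan_Normal_Form.VS_Connect"
begin

text \<open>
  A simple graph is given by its vertex set \<open>V\<close> and its edge set \<open>E\<close>, a set of two-element
  subsets of \<open>V\<close>.
\<close>

definition complete_edges :: "'a set \<Rightarrow> 'a set set"
  where "complete_edges V = {e. e \<subseteq> V \<and> card e = 2}"

definition random_graph :: "nat \<Rightarrow> real \<Rightarrow> nat set set pmf"
  where "random_graph n p =
    map_pmf (\<lambda>f. {e \<in> complete_edges {1..n}. f e})
      (Pi_pmf (complete_edges {1..n}) False (\<lambda>_. bernoulli_pmf p))"

definition edge_degree :: "'a set set \<Rightarrow> 'a \<Rightarrow> nat"
  where "edge_degree C v = card {e \<in> C. v \<in> e}"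

text \<open>
  A 2-regular graph has no isolated vertices, so a circuit is determined by its edge set \<open>C\<close>,
  and its vertex set is \<open>\<Union>C\<close>.
\<close>

definition circuit :: "'a set set \<Rightarrow> bool"
  where "circuit C \<longleftrightarrow>
    finite C \<and> C \<noteq> {} \<and> (\<forall>e\<in>C. card e = 2) \<and>
    (\<forall>v\<in>\<Union>C. edge_degree C v = 2) \<and>
    (\<forall>u\<in>\<Union>C. \<forall>v\<in>\<Union>C. (u, v) \<in> {(x, y). {x, y} \<in> C}\<^sup>*)"

definition circuits :: "'a set set \<Rightarrow> 'a set set set"
  where "circuits E = {C. C \<subseteq> E \<and> circuit C}"

definition hamilton_circuits :: "'a set \<Rightarrow> 'a set set \<Rightarrow> 'a set set set"
  where "hamilton_circuits V E = {C \<in> circuits E. \<Union>C = V}"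

definition F2 :: "bit ring"
  where "F2 = class_ring"

definition edge_space :: "'a set set \<Rightarrow> (bit, 'a set \<Rightarrow> bit) module"
  where "edge_space E = LinearCombinations.ring.func_space F2 E"

definition edge_vec :: "'a set set \<Rightarrow> 'a set set \<Rightarrow> 'a set \<Rightarrow> bit"
  where "edge_vec E C = (\<lambda>e\<in>E. if e \<in> C then 1 else 0)"

definition F2_span :: "'a set set \<Rightarrow> 'a set set set \<Rightarrow> ('a set \<Rightarrow> bit) set"
  where "F2_span E S = LinearCombinations.module.span F2 (edge_space E) (edge_vec E ` S)"

definition cycle_space :: "'a set set \<Rightarrow> ('a set \<Rightarrow> bit) set"
  where "cycle_space E =
    {f \<in> carrier (edge_space E). \<forall>v. even (edge_degree {e \<in> E. f e = 1} v)}"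

text \<open>
  The quotient \<open>V / U\<close> of a module by a submodule. Its elements are the cosets of \<open>U\<close>; the
  ring fields \<open>mult\<close> and \<open>one\<close> of the record play no role in a module.
\<close>

definition quotient_space ::
    "('k, 'v, 'm) module_scheme \<Rightarrow> 'v set \<Rightarrow> ('k, 'v set) module"
  where "quotient_space V U =
    \<lparr>carrier = a_rcosets\<^bsub>V\<^esub> U,
     mult = (\<lambda>_ _. U),
     one = U,
     zero = U,
     add = (\<lambda>X Y. X <+>\<^bsub>V\<^esub> Y),
     smult = (\<lambda>c X. \<Union>x\<in>X. U +>\<^bsub>V\<^esub> (c \<odot>\<^bsub>V\<^esub> x))\<rparr>"

lemma quotient_space_vectorspace:
  assumes "vectorspace K V" and "subspace K U V"
  shows "vectorspace K (quotient_space V U)"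
proof -
  interpret vectorspace K V by fact
  have sub: "submodule K U V"
    using assms(2) by (simp add: subspace_def)
  have subU: "U \<subseteq> carrier V" and smU: "\<And>c u. c \<in> carrier K \<Longrightarrow> u \<in> U \<Longrightarrow> c \<odot>\<^bsub>V\<^esub> u \<in> U"
    using sub by (auto simp: LinearCombinations.submodule_def)
  have "subgroup U (add_monoid V)"
  proof (rule group.subgroupI[OF M.a_group])
    fix u assume "u \<in> U"
    then have "(\<ominus>\<^bsub>K\<^esub> \<one>\<^bsub>K\<^esub>) \<odot>\<^bsub>V\<^esub> u \<in> U" and "u \<in> carrier V"
      using smU subU by auto
    then show "inv\<^bsub>add_monoid V\<^esub> u \<in> U"
      by (metis smult_minus_1 a_inv_def)
  qed (use sub in \<open>auto simp: LinearCombinations.submodule_def\<close>)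
  then interpret S: abelian_subgroup U V
    by (intro abelian_subgroupI3) (auto simp: additive_subgroup_def M.abelian_group_axioms)
  have smult: "(\<Union>y\<in>U +>\<^bsub>V\<^esub> x. U +>\<^bsub>V\<^esub> (c \<odot>\<^bsub>V\<^esub> y)) = U +>\<^bsub>V\<^esub> (c \<odot>\<^bsub>V\<^esub> x)"
    if c: "c \<in> carrier K" and x: "x \<in> carrier V" for c x
  proof -
    have "U +>\<^bsub>V\<^esub> (c \<odot>\<^bsub>V\<^esub> y) = U +>\<^bsub>V\<^esub> (c \<odot>\<^bsub>V\<^esub> x)" if y: "y \<in> U +>\<^bsub>V\<^esub> x" for y
    proof -
      obtain u where u: "u \<in> U" "y = u \<oplus>\<^bsub>V\<^esub> x"
        using y by (auto simp: a_r_coset_def')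
      have "c \<odot>\<^bsub>V\<^esub> y = c \<odot>\<^bsub>V\<^esub> u \<oplus>\<^bsub>V\<^esub> c \<odot>\<^bsub>V\<^esub> x"
        using u c x subU by (auto simp: smult_r_distr)
      hence "c \<odot>\<^bsub>V\<^esub> y \<in> U +>\<^bsub>V\<^esub> (c \<odot>\<^bsub>V\<^esub> x)"
        using smU[OF c u(1)] by (auto simp: a_r_coset_def')
      thus ?thesis
        using M.a_repr_independence[OF _ _ S.a_subgroup] c x by auto
    qed
    moreover have "x \<in> U +>\<^bsub>V\<^esub> x" using S.a_rcos_self x by auto
    ultimately show ?thesis by blast
  qed
  have U0: "U = U +>\<^bsub>V\<^esub> \<zero>\<^bsub>V\<^esub>"
    using subU by (simp add: M.a_coset_add_zero)
  have carr: "carrier (quotient_space V U) = (\<lambda>x. U +>\<^bsub>V\<^esub> x) ` carrier V"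
    by (auto simp: quotient_space_def A_RCOSETS_def')
  have zero: "\<zero>\<^bsub>quotient_space V U\<^esub> = U +>\<^bsub>V\<^esub> \<zero>\<^bsub>V\<^esub>"
    using U0 by (simp add: quotient_space_def)
  have add: "(U +>\<^bsub>V\<^esub> x) \<oplus>\<^bsub>quotient_space V U\<^esub> (U +>\<^bsub>V\<^esub> y) = U +>\<^bsub>V\<^esub> (x \<oplus>\<^bsub>V\<^esub> y)"
    if "x \<in> carrier V" "y \<in> carrier V" for x y
    using S.a_rcos_sum that by (simp add: quotient_space_def)
  have sm: "c \<odot>\<^bsub>quotient_space V U\<^esub> (U +>\<^bsub>V\<^esub> x) = U +>\<^bsub>V\<^esub> (c \<odot>\<^bsub>V\<^esub> x)"
    if "c \<in> carrier K" "x \<in> carrier V" for c x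
    using smult that by (simp add: quotient_space_def)
  have neg: "\<exists>z\<in>carrier V. U +>\<^bsub>V\<^esub> (x \<oplus>\<^bsub>V\<^esub> z) = U +>\<^bsub>V\<^esub> \<zero>\<^bsub>V\<^esub>" if "x \<in> carrier V" for x
    using that by (intro bexI[of _ "\<ominus>\<^bsub>V\<^esub> x"]) (auto simp: M.r_neg)
  show ?thesis
    by (rule vs_criteria)
      (auto simp: carr zero add sm neg field.field_axioms M.a_comm M.a_lcomm M.a_assoc smult_assoc1
        smult_l_distr smult_r_distr intro!: imageI)
qed

lemma edge_space_vectorspace: "vectorspace F2 (edge_space E)"
  unfolding edge_space_def F2_def by (rule vectorspace.func_space_is_vs[OF matrix_vs])

lemma edge_space_simps:
  "carrier (edge_space E) = E \<rightarrow>\<^sub>E UNIV"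
  "\<zero>\<^bsub>edge_space E\<^esub> = (\<lambda>e\<in>E. 0)"
  "f \<oplus>\<^bsub>edge_space E\<^esub> g = (\<lambda>e\<in>E. f e + g e)"
  "c \<odot>\<^bsub>edge_space E\<^esub> f = (\<lambda>e\<in>E. c * f e)"
  by (simp_all only: edge_space_def F2_def class_ring.func_space_def module.simps ring.simps
      monoid.simps partial_object.simps)

lemma even_card_ones_iff:
  fixes f :: "'a \<Rightarrow> bit"
  assumes "finite A"
  shows "even (card {e \<in> A. f e = 1}) \<longleftrightarrow> sum f A = 0"
proof -
  have "sum f A = (\<Sum>e\<in>A. if f e = 1 then 1 else 0)"
    by (intro sum.cong) auto
  also have "\<dots> = of_nat (card {e \<in> A. f e = 1})"
    using assms by (simp add: sum.If_cases Int_def)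
  finally have "sum f A = of_nat (card {e \<in> A. f e = 1})" .
  moreover have "(of_nat n :: bit) = 0 \<longleftrightarrow> even n" for n
    by (induction n) (auto simp del: add_bit_eq_xor)
  ultimately show ?thesis by simp
qed

lemma cycle_space_iff:
  assumes "finite E"
  shows "f \<in> cycle_space E \<longleftrightarrow>
    f \<in> carrier (edge_space E) \<and> (\<forall>v. (\<Sum>e | e \<in> E \<and> v \<in> e. f e) = 0)"
proof -
  have "edge_degree {e \<in> E. f e = 1} v = card {e \<in> {e \<in> E. v \<in> e}. f e = 1}" for v
    unfolding edge_degree_def by (rule arg_cong[of _ _ card]) auto
  then have "even (edge_degree {e \<in> E. f e = 1} v) \<longleftrightarrow> (\<Sum>e | e \<in> E \<and> v \<in> e. f e) = 0" for v
    using even_card_ones_iff[of "{e \<in> E. v \<in> e}" f] assms by simp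
  then show ?thesis
    by (simp add: cycle_space_def)
qed

lemma cycle_space_subspace:
  assumes "finite E"
  shows "subspace F2 (cycle_space E) (edge_space E)"
proof -
  interpret vectorspace F2 "edge_space E" by (rule edge_space_vectorspace)
  have "LinearCombinations.submodule F2 (cycle_space E) (edge_space E)"
  proof
    show "cycle_space E \<subseteq> carrier (edge_space E)"
      by (auto simp: cycle_space_def)
  next
    fix f g assume "f \<in> cycle_space E" "g \<in> cycle_space E"
    then show "f \<oplus>\<^bsub>edge_space E\<^esub> g \<in> cycle_space E"
      using assms
      by (simp add: cycle_space_iff edge_space_simps sum.distrib del: add_bit_eq_xor)
  next
    show "\<zero>\<^bsub>edge_space E\<^esub> \<in> cycle_space E"
      using assms by (simp add: cycle_space_iff edge_space_simps)
  next
    fix c f assume "f \<in> cycle_space E"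
    then show "c \<odot>\<^bsub>edge_space E\<^esub> f \<in> cycle_space E"
      using assms
      by (simp add: cycle_space_iff edge_space_simps del: mult_bit_eq_and flip: sum_distrib_left)
  qed
  then show ?thesis
    using vectorspace_axioms by (auto simp: VectorSpace.subspace_def)
qed

lemma circuit_in_cycle_space:
  assumes "C \<in> circuits E"
  shows "edge_vec E C \<in> cycle_space E"
proof -
  have C: "C \<subseteq> E" "circuit C" using assms by (auto simp: circuits_def)
  have "{e \<in> E. edge_vec E C e = 1} = C"
    using C(1) by (auto simp: edge_vec_def split: if_splits)
  moreover have "even (edge_degree C v)" for v
  proof (cases "v \<in> \<Union>C")
    case True
    then show ?thesis using C(2) by (auto simp: circuit_def)
  next
    case False
    then have "{e \<in> C. v \<in> e} = {}" by auto
    then show ?thesis by (simp only: edge_degree_def card.empty) simp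
  qed
  ultimately show ?thesis
    by (simp add: cycle_space_def) (simp add: edge_space_simps edge_vec_def)
qed

lemma F2_span_circuits_subspace:
  assumes "finite E" and "S \<subseteq> circuits E"
  shows "subspace F2 (F2_span E S) (edge_space E\<lparr>carrier := cycle_space E\<rparr>)"
proof -
  interpret vectorspace F2 "edge_space E" by (rule edge_space_vectorspace)
  have Z: "subspace F2 (cycle_space E) (edge_space E)"
    using assms(1) by (rule cycle_space_subspace)
  have sub: "edge_vec E ` S \<subseteq> cycle_space E"
    using assms(2) circuit_in_cycle_space by auto
  have "edge_vec E ` S \<subseteq> carrier (edge_space E)"
    using sub by (auto simp: cycle_space_def)
  then have "subspace F2 (F2_span E S) (edge_space E)"
    unfolding F2_span_def by (rule span_is_subspace)
  moreover have "F2_span E S \<subseteq> cycle_space E"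
    unfolding F2_span_def using sub Z by (intro span_is_subset) (auto simp: VectorSpace.subspace_def)
  ultimately show ?thesis
    using subspace_is_vs[OF Z]
    by (auto simp: VectorSpace.subspace_def LinearCombinations.submodule_def vectorspace.axioms(1))
qed

lemma cycle_space_quotient_vectorspace:
  assumes "finite E" and "S \<subseteq> circuits E"
  shows "vectorspace F2 (quotient_space (edge_space E\<lparr>carrier := cycle_space E\<rparr>) (F2_span E S))"
  using quotient_space_vectorspace vectorspace.subspace_is_vs
    edge_space_vectorspace cycle_space_subspace F2_span_circuits_subspace assms by blast

end

theory Submission
  imports Defs "HOL-Library.Function_Algebras" "HOL-Real_Asymp.Real_Asymp"
begin

text \<open>
  With \<open>m\<close> slightly below \<open>n powr (1/2)\<close>, the random graph asymptotically almost surely has an edge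
  between any two disjoint sets of \<open>m\<close> vertices and minimum degree at least \<open>100 * m\<close>. Everything
  else is deterministic. Since the minimum degree exceeds the independence number by far, the
  argument of Chvatal and Erdos yields Hamilton paths between any two vertices, even after
  the deletion of a few vertices. Consequently every circuit of length 8 is a sum of two Hamilton
  circuits. Modulo the span of the Hamilton circuits, octagons through a fixed vertex give every edge
  \<open>uv\<close> the form \<open>G u + G v + T\<close>, so every element of the cycle space with an even number of edges
  vanishes there, and adjoining a single odd circuit generates the whole cycle space. A circuit of
  length \<open>n - 1\<close> is a Hamilton circuit of the graph without one vertex.
\<close>

section \<open>Vectors over the field with two elements\<close>

lemma bit_fun_add_self [simp]: "f + f = (0 :: 'a \<Rightarrow> bit)"
  by (simp add: fun_eq_iff)

text \<open>With \<open>bit_fun_add_self\<close>, this lets simp with \<open>add_ac\<close> sort a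
  sum and cancel repeated terms; most identities modulo 2 below are proved that way.\<close>

lemma bit_fun_add_self_left [simp]: "f + (f + g) = (g :: 'a \<Rightarrow> bit)"
  by (simp add: fun_eq_iff)

lemma bit_fun_sum_const_even: "even (card A) \<Longrightarrow> (\<Sum>x\<in>A. c) = (0 :: 'a \<Rightarrow> bit)"
proof -
  have "(\<Sum>x\<in>A. c) = (if even (card A) then 0 else c)"
    by (induction A rule: infinite_finite_induct) (auto simp del: sum_constant)
  then show "even (card A) \<Longrightarrow> (\<Sum>x\<in>A. c) = 0" by simp
qed

text \<open>Sums of functions should stay symbolic sums, so that the two cancellation rules can
  match them.\<close>

declare plus_fun_apply [simp del] add_bit_eq_xor [simp del]

text \<open>Over the field with two elements, linear combinations are finite sums of generators.
  Working with total functions gives pointwise addition as a type-class operation;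
  \<open>restrict_span2_F2_span\<close> returns to the edge space.\<close>

inductive_set span2 :: "('a \<Rightarrow> bit) set \<Rightarrow> ('a \<Rightarrow> bit) set" for S where
  zero: "0 \<in> span2 S"
| add: "a \<in> S \<Longrightarrow> b \<in> span2 S \<Longrightarrow> a + b \<in> span2 S"

lemma span2_base: "a \<in> S \<Longrightarrow> a \<in> span2 S"
  using span2.add[OF _ span2.zero] by simp

lemma span2_add: "a \<in> span2 S \<Longrightarrow> b \<in> span2 S \<Longrightarrow> a + b \<in> span2 S"
  by (induction rule: span2.induct) (auto simp: add.assoc intro: span2.add)

lemma span2_sum: "(\<And>x. x \<in> A \<Longrightarrow> f x \<in> span2 S) \<Longrightarrow> sum f A \<in> span2 S"
  by (induction A rule: infinite_finite_induct) (auto intro: span2.zero span2_add)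

definition char_vec :: "'a set \<Rightarrow> 'a \<Rightarrow> bit"
  where "char_vec C = (\<lambda>e. of_bool (e \<in> C))"

abbreviation edge_fun :: "'a \<Rightarrow> 'a \<Rightarrow> 'a set \<Rightarrow> bit"
  where "edge_fun u v \<equiv> char_vec {{u, v}}"

lemma char_vec_empty [simp]: "char_vec {} = 0"
  by (simp add: char_vec_def fun_eq_iff)

lemma char_vec_insert: "C \<noteq> {} \<Longrightarrow> e \<notin> C \<Longrightarrow> char_vec (insert e C) = char_vec {e} + char_vec C"
  by (rule ext, rename_tac x, case_tac "x = e") (auto simp: char_vec_def plus_fun_apply)

lemma char_vec_eq_sum: "finite C \<Longrightarrow> char_vec C = (\<Sum>e\<in>C. char_vec {e})"
proof (induction C rule: finite_induct)
  case (insert e C)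
  then show ?case using char_vec_insert[of C e] by (cases "C = {}") simp_all
qed simp

section \<open>Walks and circuits as lists\<close>

text \<open>Edges are counted modulo 2 along the walk, so concatenation becomes addition and pieces
  traversed twice cancel. A closed walk repeats its first vertex at the end.\<close>

fun walk_sum :: "'a list \<Rightarrow> 'a set \<Rightarrow> bit" where
  "walk_sum (x # y # xs) = edge_fun x y + walk_sum (y # xs)"
| "walk_sum _ = 0"

fun path_edges :: "'a list \<Rightarrow> 'a set set" where
  "path_edges (x # y # xs) = insert {x, y} (path_edges (y # xs))"
| "path_edges _ = {}"

definition circuit_edges :: "'a list \<Rightarrow> 'a set set"
  where "circuit_edges xs = insert {last xs, hd xs} (path_edges xs)"

lemma walk_sum_Cons: "xs \<noteq> [] \<Longrightarrow> walk_sum (x # xs) = edge_fun x (hd xs) + walk_sum xs"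
  by (cases xs) auto

lemma walk_sum_append:
  "xs \<noteq> [] \<Longrightarrow> ys \<noteq> [] \<Longrightarrow>
    walk_sum (xs @ ys) = walk_sum xs + (edge_fun (last xs) (hd ys) + walk_sum ys)"
  by (induction xs rule: walk_sum.induct) (auto simp: walk_sum_Cons add.assoc)

lemma walk_sum_rev: "walk_sum (rev xs) = walk_sum xs"
proof (induction xs rule: walk_sum.induct)
  case (1 x y xs)
  then show ?case
    using walk_sum_append[of "rev xs @ [y]" "[x]"]
    by (simp add: insert_commute[of y x] add.commute[of "edge_fun x y"])
qed auto

lemma path_edges_append:
  "xs \<noteq> [] \<Longrightarrow> ys \<noteq> [] \<Longrightarrow>
    path_edges (xs @ ys) = insert {last xs, hd ys} (path_edges xs \<union> path_edges ys)"
  by (induction xs rule: path_edges.induct) (auto simp: neq_Nil_conv)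

lemma Union_path_edges: "\<Union>(path_edges xs) \<subseteq> set xs"
  by (induction xs rule: path_edges.induct) auto

lemma path_edges_subset: "e \<in> path_edges xs \<Longrightarrow> e \<subseteq> set xs"
  using Union_path_edges[of xs] by blast

lemma finite_path_edges [simp]: "finite (path_edges xs)"
  by (induction xs rule: path_edges.induct) auto

lemma path_edges_card2: "distinct xs \<Longrightarrow> e \<in> path_edges xs \<Longrightarrow> card e = 2"
  by (induction xs rule: path_edges.induct) auto

lemma path_edges_successively:
  "successively (\<lambda>x y. {x, y} \<in> E) xs \<Longrightarrow> path_edges xs \<subseteq> E"
  by (induction xs rule: path_edges.induct) auto

lemma card_path_edges: "distinct xs \<Longrightarrow> card (path_edges xs) = length xs - 1"
proof (induction xs rule: path_edges.induct)
  case (1 x y xs)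
  then have "{x, y} \<notin> path_edges (y # xs)"
    using path_edges_subset[of "{x, y}" "y # xs"] by auto
  with 1 show ?case by simp
qed auto

lemma walk_sum_distinct: "distinct xs \<Longrightarrow> walk_sum xs = char_vec (path_edges xs)"
proof (induction xs rule: path_edges.induct)
  case (1 x y xs)
  then have "{x, y} \<notin> path_edges (y # xs)"
    using path_edges_subset[of "{x, y}" "y # xs"] by auto
  with 1 show ?case by (cases xs) (simp_all add: char_vec_insert)
qed auto

text \<open>The only path edge at the head is the first one, and the last vertex is not its other
  end. With two vertices the closing edge would coincide with that edge, hence the bound 3.\<close>

lemma closing_edge_notin:
  assumes "distinct xs" and "length xs \<ge> 3"
  shows "{last xs, hd xs} \<notin> path_edges xs"
proof
  assume *: "{last xs, hd xs} \<in> path_edges xs"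
  obtain x y ys where xs: "xs = x # y # ys" "ys \<noteq> []"
    using assms(2) by (cases xs; cases "tl xs"; cases "tl (tl xs)") auto
  have "{last ys, x} = {x, y} \<or> {last ys, x} \<subseteq> set (y # ys)"
    using * path_edges_subset[of "{last ys, x}" "y # ys"] xs by auto
  with assms(1) xs show False
    by (auto simp: doubleton_eq_iff)
qed

lemma walk_sum_closed:
  assumes "distinct xs" and "length xs \<ge> 3"
  shows "walk_sum (xs @ [hd xs]) = char_vec (circuit_edges xs)"
proof -
  have "path_edges xs \<noteq> {}" "xs \<noteq> []"
    using assms(2) by (cases xs; cases "tl xs"; auto)+
  then show ?thesis
    using closing_edge_notin[OF assms] assms(1)
    by (simp add: walk_sum_append circuit_edges_def char_vec_insert walk_sum_distinct
        add.commute[of "char_vec (path_edges xs)"])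
qed

lemma card_circuit_edges:
  assumes "distinct xs" and "length xs \<ge> 3"
  shows "card (circuit_edges xs) = length xs"
  using closing_edge_notin[OF assms] assms by (simp add: circuit_edges_def card_path_edges)

lemma circuit_edges_rotate: "circuit_edges (xs @ ys) = circuit_edges (ys @ xs)"
  by (cases "xs = []"; cases "ys = []") (auto simp: circuit_edges_def path_edges_append)

lemma path_edges_connected:
  "u \<in> set xs \<Longrightarrow> (hd xs, u) \<in> {(x, y). {x, y} \<in> path_edges xs}\<^sup>*"
proof (induction xs rule: path_edges.induct)
  case (1 x y xs)
  let ?R = "\<lambda>zs. {(x, y). {x, y} \<in> path_edges zs}"
  show ?case
  proof (cases "u = x")
    case False
    then have "(y, u) \<in> (?R (y # xs))\<^sup>*" using 1 by auto
    then have "(y, u) \<in> (?R (x # y # xs))\<^sup>*"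
      by (rule rtrancl_mono[THEN subsetD, rotated]) auto
    moreover have "(x, y) \<in> ?R (x # y # xs)" by simp
    ultimately show ?thesis by (simp add: converse_rtrancl_into_rtrancl del: path_edges.simps)
  qed auto
qed auto

lemma Union_circuit_edges:
  assumes "length xs \<ge> 2"
  shows "\<Union>(circuit_edges xs) = set xs"
proof -
  have "length xs \<ge> 2 \<Longrightarrow> set xs \<subseteq> \<Union>(path_edges xs)" for xs :: "'a list"
  proof (induction xs rule: path_edges.induct)
    case (1 x y xs)
    then show ?case by (cases xs) auto
  qed auto
  from this[of xs] assms have "set xs = \<Union>(path_edges xs)"
    using Union_path_edges[of xs] by (intro equalityI) auto
  moreover have "{last xs, hd xs} \<subseteq> set xs"
    using assms by (cases xs) auto
  ultimately show ?thesis
    by (auto simp: circuit_edges_def)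
qed

lemma circuit_circuit_edges:
  assumes "distinct xs" and "length xs \<ge> 3"
  shows "circuit (circuit_edges xs)"
proof -
  let ?C = "circuit_edges xs"
  have un: "\<Union>?C = set xs"
    using assms(2) by (intro Union_circuit_edges) linarith
  have ne: "xs \<noteq> []" and lh: "last xs \<noteq> hd xs"
    using assms by (cases xs; auto)+
  have "edge_degree ?C v = 2" if "v \<in> set xs" for v
  proof -
    obtain as bs where xs: "xs = as @ v # bs"
      using \<open>v \<in> set xs\<close> by (meson split_list)
    \<comment> \<open>Rotating the circuit brings \<open>v\<close> to the front, where its two edges
      are the first edge and the closing edge.\<close>
    define ys where "ys = bs @ as"
    have ys: "length ys \<ge> 2" "distinct ys" "v \<notin> set ys" "ys \<noteq> []"
      using assms xs by (auto simp: ys_def)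
    have "?C = circuit_edges (v # ys)"
      using circuit_edges_rotate[of as "v # bs"] by (simp add: xs ys_def)
    also have "\<dots> = insert {last ys, v} (insert {v, hd ys} (path_edges ys))"
      using ys(4) by (cases ys) (auto simp: circuit_edges_def)
    finally have "{e \<in> ?C. v \<in> e} = {{last ys, v}, {v, hd ys}}"
      using path_edges_subset[of _ ys] ys(3) by auto
    moreover have "{last ys, v} \<noteq> {v, hd ys}"
      using ys by (cases ys) (auto simp: doubleton_eq_iff)
    ultimately show ?thesis
      by (simp add: edge_degree_def)
  qed
  moreover have "(u, v) \<in> {(x, y). {x, y} \<in> ?C}\<^sup>*" if "u \<in> set xs" "v \<in> set xs" for u v
  proof -
    let ?R = "{(x, y). {x, y} \<in> ?C}"
    have R: "{(x, y). {x, y} \<in> path_edges xs}\<^sup>* \<subseteq> ?R\<^sup>*"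
      by (rule rtrancl_mono) (auto simp: circuit_edges_def)
    \<comment> \<open>Every vertex is reachable from the head; symmetry turns this into reachability
      between any two vertices.\<close>
    have "sym ?R" by (auto simp: sym_def insert_commute)
    then have "sym (?R\<^sup>*)" by (rule sym_rtrancl)
    with R path_edges_connected[OF that(1)] path_edges_connected[OF that(2)] show ?thesis
      by (meson rtrancl_trans subsetD symD)
  qed
  moreover have "finite ?C" "?C \<noteq> {}" "\<forall>e\<in>?C. card e = 2"
    using path_edges_card2[OF assms(1)] lh by (auto simp: circuit_edges_def)
  ultimately show ?thesis
    unfolding circuit_def un by blast
qed

section \<open>Hamilton paths in graphs without large bipartite holes\<close>

text \<open>A step to a vertex already visited cuts the path back to that vertex. The bound on
  \<open>set xs\<close> later keeps such a path away from the longest path.\<close>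

lemma rtrancl_distinct_path:
  assumes "(a, b) \<in> r\<^sup>*"
  shows "\<exists>xs. xs \<noteq> [] \<and> hd xs = a \<and> last xs = b \<and> distinct xs \<and>
    successively (\<lambda>x y. (x, y) \<in> r) xs \<and> set xs \<subseteq> insert a (Range r)"
  using assms
proof (induction rule: rtrancl_induct)
  case base
  show ?case by (intro exI[of _ "[a]"]) auto
next
  case (step y z)
  then obtain xs where xs: "xs \<noteq> []" "hd xs = a" "last xs = y" "distinct xs"
    "successively (\<lambda>x y. (x, y) \<in> r) xs" "set xs \<subseteq> insert a (Range r)" by blast
  show ?case
  proof (cases "z \<in> set xs")
    case True
    then obtain as bs where *: "xs = as @ z # bs" by (meson split_list)
    show ?thesis
      using xs unfolding *
      by (intro exI[of _ "as @ [z]"]) (auto simp: successively_append_iff hd_append)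
  next
    case False
    with xs step(2) show ?thesis
      by (intro exI[of _ "xs @ [z]"]) (auto simp: successively_append_iff)
  qed
qed

text \<open>These are the only properties of the random graph used by the deterministic part. The
  factor 100 leaves room for all forbidden sets below, and \<open>m_pos\<close> lets absolute
  constants be absorbed into multiples of \<open>m\<close>.\<close>

locale dense_expander =
  fixes V :: "'a set" and E :: "'a set set" and m :: nat
  assumes finite_V: "finite V"
    and edges: "E \<subseteq> complete_edges V"
    and m_pos: "m \<ge> 1"
    and min_degree: "v \<in> V \<Longrightarrow> card {u. {u, v} \<in> E} \<ge> 100 * m"
    and no_hole: "A \<subseteq> V \<Longrightarrow> B \<subseteq> V \<Longrightarrow> A \<inter> B = {} \<Longrightarrow> card A = m \<Longrightarrow> card B = m \<Longrightarrow>
      \<exists>a\<in>A. \<exists>b\<in>B. {a, b} \<in> E"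
begin

definition is_path :: "'a list \<Rightarrow> bool"
  where "is_path xs \<longleftrightarrow> distinct xs \<and> successively (\<lambda>x y. {x, y} \<in> E) xs"

definition nbrs :: "'a \<Rightarrow> 'a set"
  where "nbrs v = {u. {u, v} \<in> E}"

lemma edge_sym: "{u, v} \<in> E \<Longrightarrow> {v, u} \<in> E"
  by (simp add: insert_commute)

lemma edgeD: "{u, v} \<in> E \<Longrightarrow> u \<in> V \<and> v \<in> V \<and> u \<noteq> v"
  using edges by (auto simp: complete_edges_def)

lemma finite_E: "finite E"
  using finite_V edges finite_subset[of E "Pow V"] by (auto simp: complete_edges_def)

lemma nbrs_V: "nbrs v \<subseteq> V"
  using edgeD by (auto simp: nbrs_def)

lemma finite_nbrs [simp]: "finite (nbrs v)"
  using nbrs_V finite_V finite_subset by blast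

section \<open>Avoiding forbidden vertices: fresh neighbours, short links and long paths\<close>

lemma card_nbrs_diff:
  assumes "v \<in> V" and "finite S" and "card S \<le> k"
  shows "card (nbrs v - S) + k \<ge> 100 * m"
proof -
  have "card (nbrs v) \<ge> 100 * m"
    using min_degree[OF assms(1)] by (simp add: nbrs_def)
  moreover have "card (nbrs v - S) \<ge> card (nbrs v) - card S"
    using diff_card_le_card_Diff[OF assms(2)] .
  ultimately show ?thesis using assms(3) by linarith
qed

lemma fresh_nbr:
  assumes "v \<in> V" and "finite S" and "card S < 100 * m"
  shows "\<exists>u. {v, u} \<in> E \<and> u \<notin> S"
proof -
  have "card (nbrs v - S) > 0"
    using card_nbrs_diff[OF assms(1,2) order_refl] assms(3) by linarith
  then have "nbrs v - S \<noteq> {}"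
    by (metis card.empty less_irrefl)
  then show ?thesis by (auto simp: nbrs_def insert_commute)
qed

lemma no_hole_ge:
  assumes "A \<subseteq> V" "B \<subseteq> V" "A \<inter> B = {}" "card A \<ge> m" "card B \<ge> m"
  shows "\<exists>a\<in>A. \<exists>b\<in>B. {a, b} \<in> E"
proof -
  obtain A' B' where "A' \<subseteq> A" "card A' = m" "B' \<subseteq> B" "card B' = m"
    using assms(4,5) by (meson obtain_subset_with_card_n)
  with assms(1-3) show ?thesis
    using no_hole[of A' B'] by blast
qed

text \<open>Splitting off \<open>m\<close> vertices leaves at least \<open>m\<close> others, and the
  two parts are joined by an edge. So independent sets have fewer than \<open>2 * m\<close>
  vertices, which is the bound in the Chvatal-Erdos argument.\<close>

lemma edge_within:
  assumes "A \<subseteq> V" "card A \<ge> 2 * m"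
  shows "\<exists>a\<in>A. \<exists>b\<in>A. {a, b} \<in> E"
proof -
  have "card A \<ge> m" using assms(2) by linarith
  then obtain B where B: "B \<subseteq> A" "card B = m" by (meson obtain_subset_with_card_n)
  have "finite B" using B(1) assms(1) finite_V by (meson finite_subset)
  then have "card (A - B) \<ge> m" using B assms(2) by (simp add: card_Diff_subset)
  then show ?thesis
    using no_hole_ge[of B "A - B"] B assms(1) by blast
qed

text \<open>Outside \<open>S\<close>, choose \<open>m\<close> neighbours of \<open>a\<close> and
  then at least \<open>m\<close> neighbours of \<open>b\<close> disjoint from them;
  \<open>no_hole_ge\<close> supplies the middle edge.\<close>

lemma link3:
  assumes "a \<in> V" "b \<in> V" "finite S" "card S \<le> 50 * m"
  shows "\<exists>x y. {a, x} \<in> E \<and> {x, y} \<in> E \<and> {y, b} \<in> E \<and>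
    x \<notin> insert a (insert b S) \<and> y \<notin> insert a (insert b S) \<and> x \<noteq> y"
proof -
  let ?S = "insert a (insert b S)"
  have S: "finite ?S" "card ?S \<le> 50 * m + 2"
    using assms(3,4) card_insert_le_m1[of 2 S] by (auto simp: card_insert_if)
  have "card (nbrs a - ?S) \<ge> m"
    using card_nbrs_diff[OF assms(1) S] m_pos by linarith
  then obtain A where A: "A \<subseteq> nbrs a - ?S" "card A = m" by (meson obtain_subset_with_card_n)
  have "finite A" using A(1) finite_nbrs by (meson finite_Diff finite_subset)
  then have "finite (?S \<union> A)" "card (?S \<union> A) \<le> 51 * m + 2"
    using S A(2) card_Un_le[of ?S A] by auto
  then have "card (nbrs b - (?S \<union> A)) \<ge> m"
    using card_nbrs_diff[OF assms(2), of "?S \<union> A"] m_pos by force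
  moreover have "A \<subseteq> V" "nbrs b - (?S \<union> A) \<subseteq> V" "A \<inter> (nbrs b - (?S \<union> A)) = {}"
    using A(1) nbrs_V[of a] nbrs_V[of b] by blast+
  ultimately obtain x y where "x \<in> A" "y \<in> nbrs b - (?S \<union> A)" "{x, y} \<in> E"
    using no_hole_ge[of A "nbrs b - (?S \<union> A)"] A(2) by auto
  then show ?thesis
    using A(1) by (intro exI[of _ x] exI[of _ y]) (auto simp: nbrs_def insert_commute)
qed

text \<open>Extend a path greedily from \<open>s\<close>, keeping \<open>t\<close> in reserve, and
  join its end to \<open>t\<close> by a link. The length guarantees that a longest path has many
  vertices adjacent to any large outside component.\<close>

lemma long_path:
  assumes "U \<subseteq> V" "card (V - U) \<le> 30 * m" "s \<in> U" "t \<in> U" "s \<noteq> t"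
  shows "\<exists>xs. is_path xs \<and> xs \<noteq> [] \<and> hd xs = s \<and> last xs = t \<and> set xs \<subseteq> U \<and> length xs \<ge> 10 * m"
proof -
  have "\<exists>xs. is_path xs \<and> length xs = Suc k \<and> hd xs = s \<and> set xs \<subseteq> U - {t}" if "k \<le> 10 * m" for k
    using that
  proof (induction k)
    case 0
    show ?case using assms by (intro exI[of _ "[s]"]) (auto simp: is_path_def)
  next
    case (Suc k)
    then obtain xs where xs: "is_path xs" "length xs = Suc k" "hd xs = s" "set xs \<subseteq> U - {t}"
      by auto
    have ne: "xs \<noteq> []" using xs(2) by auto
    let ?S = "(V - U) \<union> insert t (set xs)"
    have "card ?S \<le> card (V - U) + (Suc (card (set xs)))"
      using card_Un_le[of "V - U" "insert t (set xs)"] card_insert_le_m1[of "Suc (card (set xs))" "set xs" t]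
      by (auto simp: card_insert_if split: if_splits)
    also have "card (set xs) \<le> Suc k" using card_length[of xs] xs(2) by simp
    finally have "card ?S < 100 * m" using assms(2) Suc.prems m_pos by linarith
    moreover have "last xs \<in> V" using ne xs(4) assms(1) by (metis Diff_iff last_in_set subset_iff)
    ultimately obtain u where u: "{last xs, u} \<in> E" "u \<notin> ?S"
      using fresh_nbr[of "last xs" ?S] finite_V by auto
    then show ?case
      using xs ne edgeD[OF u(1)]
      by (intro exI[of _ "xs @ [u]"]) (auto simp: is_path_def successively_append_iff)
  qed
  from this[of "10 * m"] obtain xs where
    xs: "is_path xs" "length xs = Suc (10 * m)" "hd xs = s" "set xs \<subseteq> U - {t}" by auto
  have ne: "xs \<noteq> []" using xs(2) by auto
  let ?S = "(V - U) \<union> set xs"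
  have "card ?S \<le> card (V - U) + card (set xs)" by (rule card_Un_le)
  also have "\<dots> \<le> 50 * m" using card_length[of xs] xs(2) assms(2) m_pos by linarith
  finally have "card ?S \<le> 50 * m" .
  moreover have "last xs \<in> V" using ne xs(4) assms(1) by (metis Diff_iff last_in_set subset_iff)
  ultimately obtain x y where xy: "{last xs, x} \<in> E" "{x, y} \<in> E" "{y, t} \<in> E"
    "x \<notin> insert (last xs) (insert t ?S)" "y \<notin> insert (last xs) (insert t ?S)" "x \<noteq> y"
    using link3[of "last xs" t ?S] finite_V assms(1,4) by blast
  have "set (xs @ [x, y, t]) \<subseteq> U"
    using xs(4) xy edgeD[OF xy(2)] assms(4) by auto
  moreover have "is_path (xs @ [x, y, t])"
    using xs xy ne by (auto simp: is_path_def successively_append_iff)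
  ultimately show ?thesis
    using xs(2,3) ne by (intro exI[of _ "xs @ [x, y, t]"]) auto
qed

text \<open>
  The argument of Chvatal and Erdos: for a longest path \<open>P\<close> and a component \<open>D\<close> outside of it, the
  successors on \<open>P\<close> of the neighbours of \<open>D\<close> are independent, but there are too many of them.
\<close>

lemma hamilton_path:
  assumes "U \<subseteq> V" "card (V - U) \<le> 30 * m" "s \<in> U" "t \<in> U" "s \<noteq> t"
  shows "\<exists>xs. is_path xs \<and> xs \<noteq> [] \<and> hd xs = s \<and> last xs = t \<and> set xs = U"
proof -
  define Q where "Q = (\<lambda>xs. is_path xs \<and> xs \<noteq> [] \<and> hd xs = s \<and> last xs = t \<and> set xs \<subseteq> U)"
  obtain P0 where P0: "Q P0" "length P0 \<ge> 10 * m"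
    using long_path[OF assms] by (auto simp: Q_def)
  have "finite U" using assms(1) finite_V finite_subset by blast
  then have "length xs < Suc (card U)" if "Q xs" for xs
    using that by (metis Q_def card_mono distinct_card is_path_def less_Suc_eq_le)
  then have "\<exists>P. Q P \<and> (\<forall>xs. Q xs \<longrightarrow> length xs \<le> length P)"
    using ex_has_greatest_nat[of Q P0 length "Suc (card U)"] P0(1) by simp
  then obtain P where P: "Q P" and max: "\<And>xs. Q xs \<Longrightarrow> length xs \<le> length P"
    by (auto simp only:)
  have len: "length P \<ge> 10 * m" using max[OF P0(1)] P0(2) by linarith
  have dP: "distinct P" and sP: "successively (\<lambda>x y. {x, y} \<in> E) P" and PU: "set P \<subseteq> U"
    using P by (auto simp: Q_def is_path_def)
  have "set P = U"
  proof (rule ccontr)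
    assume "set P \<noteq> U"
    then obtain v where v: "v \<in> U - set P" using PU by blast
    \<comment> \<open>The component of \<open>v\<close> in the graph induced on the vertices of
      \<open>U\<close> missed by \<open>P\<close> is the class \<open>D\<close> of \<open>v\<close>
      under \<open>r\<^sup>*\<close>.\<close>
    define r where "r = {(x, y). x \<in> U - set P \<and> y \<in> U - set P \<and> {x, y} \<in> E}"
    define D where "D = r\<^sup>* `` {v}"
    have symr: "sym (r\<^sup>*)" by (rule sym_rtrancl) (auto simp: r_def sym_def insert_commute)
    have D_sub: "D \<subseteq> U - set P"
      using v unfolding D_def by (auto elim: rtranclE simp: r_def)
    have D_closed: "w \<in> D" if "d \<in> D" "w \<in> U - set P" "{d, w} \<in> E" for d w
      using that D_sub unfolding D_def r_def by (auto intro: rtrancl_into_rtrancl)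
    have D_path: "\<exists>xs. is_path xs \<and> xs \<noteq> [] \<and> hd xs = d \<and> last xs = d' \<and> set xs \<inter> set P = {} \<and> set xs \<subseteq> U"
      if dd: "d \<in> D" "d' \<in> D" for d d'
    proof -
      have "(d, v) \<in> r\<^sup>*" "(v, d') \<in> r\<^sup>*"
        using dd symr by (auto simp: D_def dest: symD)
      then have "(d, d') \<in> r\<^sup>*" by (rule rtrancl_trans)
      then obtain xs where xs: "xs \<noteq> []" "hd xs = d" "last xs = d'" "distinct xs"
        "successively (\<lambda>x y. (x, y) \<in> r) xs" "set xs \<subseteq> insert d (Range r)"
        using rtrancl_distinct_path by metis
      have "successively (\<lambda>x y. {x, y} \<in> E) xs"
        using xs(5) by (rule successively_mono) (auto simp: r_def)
      moreover have "set xs \<subseteq> U - set P"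
        using xs(6) dd(1) D_sub by (auto simp: r_def)
      ultimately show ?thesis
        using xs by (auto simp: is_path_def)
    qed
    define NP where "NP = {x \<in> set P. \<exists>d\<in>D. {d, x} \<in> E}"
    have DV: "D \<subseteq> V" using D_sub assms(1) by auto
    have "finite D" using DV finite_V finite_subset by blast
    \<comment> \<open>If \<open>D\<close> has at least \<open>m\<close> vertices, the absence of
      holes makes it adjacent to all but fewer than \<open>m\<close> vertices of \<open>P\<close>.
      If \<open>D\<close> is smaller, most neighbours of \<open>v\<close> inside \<open>U\<close>
      must lie on \<open>P\<close>.\<close>
    have card_NP: "card NP \<ge> 2 * m + 1"
    proof (cases "card D \<ge> m")
      case True
      have "card (set P - NP) < m"
      proof (rule ccontr)
        assume "\<not> card (set P - NP) < m"
        then have "\<exists>a\<in>D. \<exists>b\<in>set P - NP. {a, b} \<in> E"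
          using D_sub PU assms(1) True DV by (intro no_hole_ge) auto
        then show False by (auto simp: NP_def)
      qed
      moreover have "card (set P - NP) = card (set P) - card NP"
        by (rule card_Diff_subset) (auto simp: NP_def)
      ultimately show ?thesis
        using len dP m_pos by (simp add: distinct_card)
    next
      case False
      have "v \<in> D" by (simp add: D_def)
      have "nbrs v - (V - U) \<subseteq> D \<union> NP"
        using D_closed[OF \<open>v \<in> D\<close>] \<open>v \<in> D\<close> nbrs_V[of v] by (auto simp: nbrs_def NP_def insert_commute)
      then have "card (nbrs v - (V - U)) \<le> card (D \<union> NP)"
        by (rule card_mono[rotated]) (use \<open>finite D\<close> in \<open>auto simp: NP_def\<close>)
      also have "\<dots> \<le> card D + card NP" by (rule card_Un_le)
      finally show ?thesis
        using card_nbrs_diff[of v "V - U" "30 * m"] v assms(1,2) finite_V False m_pos by force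
    qed
    \<comment> \<open>The last vertex of \<open>P\<close> has no successor; the surplus 1 in
      \<open>card_NP\<close> pays for losing it.\<close>
    define I where "I = {i. Suc i < length P \<and> P ! i \<in> NP}"
    have finI: "finite I" by (rule finite_subset[of _ "{..<length P}"]) (auto simp: I_def)
    have "NP - {last P} \<subseteq> (!) P ` I"
    proof
      fix x assume x: "x \<in> NP - {last P}"
      then obtain i where i: "i < length P" "P ! i = x"
        by (auto simp: NP_def in_set_conv_nth)
      have "Suc i \<noteq> length P"
      proof
        assume *: "Suc i = length P"
        then have "P \<noteq> []" "length P - 1 = i" by auto
        then have "last P = P ! i" by (simp add: last_conv_nth)
        with i x show False by auto
      qed
      with i x show "x \<in> (!) P ` I" by (auto simp: I_def)
    qed
    then have "card (NP - {last P}) \<le> card I"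
      by (rule surj_card_le[OF finI])
    moreover have "card (NP - {last P}) \<ge> card NP - 1"
      using diff_card_le_card_Diff[of "{last P}" NP] by simp
    ultimately have "card I \<ge> 2 * m" using card_NP by linarith
    moreover have "inj_on (\<lambda>i. P ! Suc i) I"
      using dP by (auto simp: inj_on_def I_def nth_eq_iff_index_eq)
    ultimately have "card ((\<lambda>i. P ! Suc i) ` I) \<ge> 2 * m"
      by (simp add: card_image)
    moreover have "(\<lambda>i. P ! Suc i) ` I \<subseteq> V"
      using PU assms(1) nth_mem[of _ P] by (auto simp: I_def subset_iff)
    ultimately obtain i j where ij: "i \<in> I" "j \<in> I" "{P ! Suc i, P ! Suc j} \<in> E"
      using edge_within[of "(\<lambda>i. P ! Suc i) ` I"] by blast
    \<comment> \<open>Write \<open>P = A @ B @ C\<close>, with \<open>A\<close> ending at position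
      \<open>i\<close> and \<open>B\<close> at position \<open>j\<close>. The detour goes from
      \<open>A\<close> through \<open>D\<close> to the end of \<open>B\<close>, back along
      \<open>B\<close>, and by the edge between the two successors into \<open>C\<close>; it
      contains all of \<open>P\<close> and more.\<close>
    have reroute: False if r: "i \<in> I" "j \<in> I" "{P ! Suc i, P ! Suc j} \<in> E" "i < j" for i j
    proof -
      define A B C where "A = take (Suc i) P" and "B = take (j - i) (drop (Suc i) P)"
        and "C = drop (Suc j) P"
      have lens: "Suc i < length P" "Suc j < length P" using r by (auto simp: I_def)
      have "drop (Suc i) P = B @ C"
        using \<open>i < j\<close> unfolding B_def C_def
        by (metis Suc_diff_Suc add.commute append_take_drop_id diff_Suc_Suc drop_drop le_add_diff_inverse2 less_imp_le not_less_eq_eq nat_less_le)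
      then have P_eq: "P = A @ B @ C" by (metis A_def append_take_drop_id)
      have ne: "A \<noteq> []" "B \<noteq> []" "C \<noteq> []"
        using lens \<open>i < j\<close> by (auto simp: A_def B_def C_def)
      have ends: "last A = P ! i" "hd B = P ! Suc i" "last B = P ! j" "hd C = P ! Suc j"
        using lens \<open>i < j\<close> ne
        by (auto simp: A_def B_def C_def last_conv_nth hd_drop_conv_nth hd_take min_def)
      obtain d d' where dd: "d \<in> D" "d' \<in> D" "{d, P ! i} \<in> E" "{d', P ! j} \<in> E"
        using r by (auto simp: I_def NP_def)
      obtain R where R: "is_path R" "R \<noteq> []" "hd R = d" "last R = d'" "set R \<inter> set P = {}"
        "set R \<subseteq> U"
        using D_path[OF dd(1,2)] by blast
      define P' where "P' = A @ R @ rev B @ C"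
      have "distinct P'"
        using dP R(1,5) unfolding P'_def P_eq by (auto simp: is_path_def)
      moreover have "successively (\<lambda>x y. {x, y} \<in> E) P'"
        using sP R(1-4) ne ends dd r(3) unfolding P'_def P_eq
        by (auto simp: successively_append_iff is_path_def insert_commute hd_rev last_rev)
      moreover have "hd P' = s" "last P' = t" "P' \<noteq> []" "set P' \<subseteq> U"
        using P ne R(6) unfolding P'_def Q_def P_eq by auto
      ultimately have "Q P'" by (simp add: Q_def is_path_def)
      moreover have "length P' > length P" using R(2) by (simp add: P'_def P_eq)
      ultimately show False using max[of P'] by simp
    qed
    have "i \<noteq> j" using edgeD[OF ij(3)] by auto
    then show False
      using reroute[OF ij] reroute[OF ij(2,1) edge_sym[OF ij(3)]] by linarith
  qed
  with P show ?thesis by (auto simp: Q_def)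
qed

end

section \<open>Sums of Hamilton circuits\<close>

context dense_expander
begin

definition hspan :: "('a set \<Rightarrow> bit) set"
  where "hspan = span2 (char_vec ` hamilton_circuits V E)"

lemmas hspan_add = span2_add[of _ "char_vec ` hamilton_circuits V E", folded hspan_def]

lemma circuit_list:
  assumes "is_path xs" "length xs \<ge> 3" "{last xs, hd xs} \<in> E"
  shows "circuit_edges xs \<in> circuits E"
  using assms circuit_circuit_edges[of xs] path_edges_successively[of E xs]
  by (auto simp: circuits_def is_path_def circuit_edges_def)

lemma hamilton_list:
  assumes "is_path xs" "length xs \<ge> 3" "{last xs, hd xs} \<in> E" "set xs = V"
  shows "circuit_edges xs \<in> hamilton_circuits V E"
  using circuit_list[OF assms(1-3)] Union_circuit_edges[of xs] assms(2,4)
  by (simp add: hamilton_circuits_def)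

lemma hamilton_walk_sum:
  assumes "is_path xs" "length xs \<ge> 3" "{last xs, hd xs} \<in> E" "set xs = V"
  shows "walk_sum (xs @ [hd xs]) \<in> hspan"
  using hamilton_list[OF assms] walk_sum_closed[of xs] assms(1,2)
  by (auto simp: hspan_def is_path_def intro!: span2_base)

text \<open>
  Join \<open>a1\<close>--\<open>a3\<close>, \<open>a2\<close>--\<open>a5\<close>, \<open>a4\<close>--\<open>a7\<close>, \<open>a6\<close>--\<open>a8\<close> by disjoint paths that cover \<open>V\<close>. This
  matching closes up to a single circuit both with the odd and with the even edges of the
  octagon, so the octagon is the sum of two Hamilton circuits.
\<close>

lemma octagon:
  assumes dist: "distinct [a1, a2, a3, a4, a5, a6, a7, a8]"
    and E: "{a1, a2} \<in> E" "{a2, a3} \<in> E" "{a3, a4} \<in> E" "{a4, a5} \<in> E"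
      "{a5, a6} \<in> E" "{a6, a7} \<in> E" "{a7, a8} \<in> E" "{a8, a1} \<in> E"
  shows "walk_sum [a1, a2, a3, a4, a5, a6, a7, a8, a1] \<in> hspan"
proof -
  let ?A = "{a1, a2, a3, a4, a5, a6, a7, a8}"
  have AV: "?A \<subseteq> V" using E edgeD by blast
  have cA: "card ?A \<le> 8" using card_length[of "[a1, a2, a3, a4, a5, a6, a7, a8]"] by simp
  obtain x1 y1 where p1: "{a1, x1} \<in> E" "{x1, y1} \<in> E" "{y1, a3} \<in> E" "x1 \<noteq> y1"
    "x1 \<notin> ?A" "y1 \<notin> ?A"
    using link3[of a1 a3 ?A] AV cA m_pos by auto
  let ?B = "insert x1 (insert y1 ?A)"
  have cB: "card ?B \<le> 10" using cA by (simp add: card_insert_if)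
  obtain x2 y2 where p2: "{a2, x2} \<in> E" "{x2, y2} \<in> E" "{y2, a5} \<in> E" "x2 \<noteq> y2"
    "x2 \<notin> ?B" "y2 \<notin> ?B"
    using link3[of a2 a5 ?B] AV cB m_pos by auto
  let ?C = "insert x2 (insert y2 ?B)"
  have cC: "card ?C \<le> 12" using cB by (simp add: card_insert_if)
  obtain x3 y3 where p3: "{a4, x3} \<in> E" "{x3, y3} \<in> E" "{y3, a7} \<in> E" "x3 \<noteq> y3"
    "x3 \<notin> ?C" "y3 \<notin> ?C"
    using link3[of a4 a7 ?C] AV cC m_pos by auto
  \<comment> \<open>\<open>X\<close> leaves out \<open>a6\<close> and \<open>a8\<close>, the ends of
    the fourth path \<open>Q\<close>, which has to absorb all remaining vertices.\<close>
  define X where "X = {a1, a2, a3, a4, a5, a7, x1, y1, x2, y2, x3, y3}"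
  have "card X \<le> 12"
    using card_length[of "[a1, a2, a3, a4, a5, a7, x1, y1, x2, y2, x3, y3]"] by (simp add: X_def)
  moreover have XV: "X \<subseteq> V" using AV p1 p2 p3 edgeD unfolding X_def by blast
  ultimately have "card (V - (V - X)) \<le> 30 * m" using m_pos by (simp add: double_diff)
  moreover have a68: "a6 \<in> V - X" "a8 \<in> V - X" "a6 \<noteq> a8"
    using AV dist p1 p2 p3 by (auto simp: X_def)
  ultimately obtain Q where Q: "is_path Q" "Q \<noteq> []" "hd Q = a6" "last Q = a8" "set Q = V - X"
    using hamilton_path[of "V - X" a6 a8] by blast
  \<comment> \<open>\<open>H1\<close> uses the octagon edges a1a2, a3a4, a5a6, a7a8 and
    \<open>H2\<close> the other four. Both contain the same four joining paths, the first one
    closing the circuit by the edge from \<open>x1\<close> to \<open>a1\<close>, so these cancel in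
    the sum.\<close>
  define H1 H2 where "H1 = [a1, a2, x2, y2, a5] @ Q @ [a7, y3, x3, a4, a3, y1, x1]"
    and "H2 = [a1] @ rev Q @ [a7, y3, x3, a4, a5, y2, x2, a2, a3, y1, x1]"
  have dX: "distinct [a1, a2, a3, a4, a5, a7, x1, y1, x2, y2, x3, y3]"
    using dist p1 p2 p3 by auto
  have notQ: "x \<notin> set Q" if "x \<in> X" for x using that Q(5) by auto
  have set: "set H1 = V" "set H2 = V"
    using Q(5) XV by (auto simp: H1_def H2_def X_def)
  have "distinct H1" "distinct H2"
    using dX Q(1) notQ unfolding H1_def H2_def is_path_def by (auto simp: X_def)
  then have path: "is_path H1" "is_path H2"
    using E p1 p2 p3 Q(1-4)
    by (auto simp: H1_def H2_def is_path_def successively_append_iff successively_Cons hd_append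
        insert_commute hd_rev last_rev)
  have len: "length H1 \<ge> 3" "length H2 \<ge> 3" by (auto simp: H1_def H2_def)
  have "walk_sum (H1 @ [hd H1]) + walk_sum (H2 @ [hd H2]) \<in> hspan"
    using path len set p1
    by (intro hspan_add hamilton_walk_sum) (auto simp: H1_def H2_def insert_commute)
  also have "walk_sum (H1 @ [hd H1]) + walk_sum (H2 @ [hd H2]) =
      walk_sum [a1, a2, a3, a4, a5, a6, a7, a8, a1]"
    using Q(2-4)
    by (simp add: H1_def H2_def walk_sum_append walk_sum_Cons walk_sum_rev hd_rev last_rev
        insert_commute add_ac)
  finally show ?thesis .
qed

section \<open>Paths with three or four edges from a fixed vertex, modulo Hamilton circuits\<close>

definition paths :: "nat \<Rightarrow> 'a \<Rightarrow> 'a \<Rightarrow> 'a list set"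
  where "paths k u v = {P. is_path P \<and> length P = Suc k \<and> hd P = u \<and> last P = v}"

lemma paths3_exists:
  assumes "c \<in> V" "u \<in> V" "c \<noteq> u" "finite S" "card S \<le> 50 * m"
  shows "\<exists>P\<in>paths 3 c u. set P \<inter> S \<subseteq> {c, u}"
proof -
  obtain x y where "{c, x} \<in> E" "{x, y} \<in> E" "{y, u} \<in> E"
    "x \<notin> insert c (insert u S)" "y \<notin> insert c (insert u S)" "x \<noteq> y"
    using link3[OF assms(1,2,4,5)] by blast
  then show ?thesis
    using assms(3) by (intro bexI[of _ "[c, x, y, u]"]) (auto simp: paths_def is_path_def)
qed

text \<open>Take a fresh neighbour \<open>z\<close> of \<open>v\<close>, reach it by a 3-path that
  avoids \<open>v\<close>, and append \<open>v\<close>.\<close>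

lemma paths4_exists:
  assumes "c \<in> V" "v \<in> V" "c \<noteq> v" "finite S" "card S \<le> 40 * m"
  shows "\<exists>P\<in>paths 4 c v. set P \<inter> S \<subseteq> {c, v}"
proof -
  have card: "card (insert c (insert v S)) \<le> 40 * m + 2"
    using assms(4,5) by (simp add: card_insert_if)
  then obtain z where z: "{v, z} \<in> E" "z \<notin> insert c (insert v S)"
    using fresh_nbr[of v "insert c (insert v S)"] assms m_pos by auto
  have "card (insert v S) \<le> 50 * m"
    using assms(4,5) m_pos by (simp add: card_insert_if)
  then obtain P where P: "P \<in> paths 3 c z" "set P \<inter> insert v S \<subseteq> {c, z}"
    using paths3_exists[of c z "insert v S"] assms(1,4) z edgeD[OF z(1)] by auto
  have "v \<notin> set P" using P(2) assms(3) z(2) by auto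
  moreover have "P \<noteq> []" using P(1) by (auto simp: paths_def)
  ultimately show ?thesis
    using P z by (intro bexI[of _ "P @ [v]"])
      (auto simp: paths_def is_path_def successively_append_iff insert_commute)
qed

lemma paths3E:
  assumes "P \<in> paths 3 c u"
  obtains x y where "P = [c, x, y, u]"
proof -
  have "length P = Suc (Suc (Suc (Suc 0)))" "hd P = c" "last P = u"
    using assms by (auto simp: paths_def)
  then show ?thesis using that by (auto simp: length_Suc_conv)
qed

lemma paths4E:
  assumes "P \<in> paths 4 c u"
  obtains x y z where "P = [c, x, y, z, u]"
proof -
  have "length P = Suc (Suc (Suc (Suc (Suc 0))))" "hd P = c" "last P = u"
    using assms by (auto simp: paths_def)
  then show ?thesis using that by (auto simp: length_Suc_conv)
qed

text \<open>The 3-path, the edge \<open>uv\<close> and the reversed 4-path close up to a circuit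
  with 3 + 1 + 4 = 8 edges.\<close>

lemma octagon_paths:
  assumes "P \<in> paths 3 c u" "R \<in> paths 4 c v" "{u, v} \<in> E" "set P \<inter> set R = {c}"
  shows "walk_sum P + (walk_sum R + edge_fun u v) \<in> hspan"
proof -
  obtain x1 x2 where P: "P = [c, x1, x2, u]"
    using assms(1) by (rule paths3E)
  obtain y1 y2 y3 where R: "R = [c, y1, y2, y3, v]"
    using assms(2) by (rule paths4E)
  have "walk_sum [c, x1, x2, u, v, y3, y2, y1, c] \<in> hspan"
    using assms unfolding P R
    by (intro octagon) (auto simp: paths_def is_path_def insert_commute)
  also have "walk_sum [c, x1, x2, u, v, y3, y2, y1, c] = walk_sum P + (walk_sum R + edge_fun u v)"
    unfolding P R by (simp add: insert_commute add_ac)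
  finally show ?thesis .
qed

lemma paths3_ends:
  assumes "P \<in> paths 3 c u"
  shows "c \<in> V" "u \<in> V" "c \<noteq> u" "card (set P) \<le> 4"
proof -
  obtain x y where P: "P = [c, x, y, u]" using assms by (rule paths3E)
  show "card (set P) \<le> 4" using card_length[of P] by (simp add: P)
  show "c \<in> V" "u \<in> V" "c \<noteq> u"
    using assms edgeD unfolding P by (auto simp: paths_def is_path_def)
qed

lemma paths4_ends:
  assumes "P \<in> paths 4 c u"
  shows "c \<in> V" "u \<in> V" "c \<noteq> u" "card (set P) \<le> 5"
proof -
  obtain x y z where P: "P = [c, x, y, z, u]" using assms by (rule paths4E)
  show "card (set P) \<le> 5" using card_length[of P] by (simp add: P)
  show "c \<in> V" "u \<in> V" "c \<noteq> u"
    using assms edgeD unfolding P by (auto simp: paths_def is_path_def)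
qed

text \<open>A fresh neighbour \<open>v\<close> of \<open>u\<close> and one 4-path to
  \<open>v\<close> avoiding both 3-paths complete each of them to an octagon. The common part
  cancels when the two octagons are added.\<close>

lemma paths3_equiv:
  assumes P: "P \<in> paths 3 c u" and P': "P' \<in> paths 3 c u"
  shows "walk_sum P + walk_sum P' \<in> hspan"
proof -
  let ?S = "set P \<union> set P'"
  have cS: "card ?S \<le> 8"
    using card_Un_le[of "set P" "set P'"] paths3_ends(4)[OF P] paths3_ends(4)[OF P'] by linarith
  then obtain v where v: "{u, v} \<in> E" "v \<notin> ?S"
    using fresh_nbr[of u ?S] paths3_ends(2)[OF P] m_pos by auto
  have "c \<in> ?S" using P by (cases P) (auto simp: paths_def)
  then obtain R where R: "R \<in> paths 4 c v" "set R \<inter> ?S \<subseteq> {c, v}"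
    using paths4_exists[of c v ?S] v edgeD[OF v(1)] paths3_ends[OF P] cS m_pos by auto
  have "c \<in> set P" "c \<in> set P'" "c \<in> set R"
    using P P' R(1) by (cases P; cases P'; cases R; auto simp: paths_def)+
  then have "set P \<inter> set R = {c}" "set P' \<inter> set R = {c}"
    using R(2) v(2) by auto
  from hspan_add[OF octagon_paths[OF P R(1) v(1) this(1)] octagon_paths[OF P' R(1) v(1) this(2)]]
  show ?thesis by (simp add: add_ac)
qed

text \<open>The same cancellation, with a common 3-path to a fresh neighbour of
  \<open>v\<close>.\<close>

lemma paths4_equiv:
  assumes R: "R \<in> paths 4 c v" and R': "R' \<in> paths 4 c v"
  shows "walk_sum R + walk_sum R' \<in> hspan"
proof -
  let ?S = "set R \<union> set R'"
  have cS: "card ?S \<le> 10"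
    using card_Un_le[of "set R" "set R'"] paths4_ends(4)[OF R] paths4_ends(4)[OF R'] by linarith
  then obtain u where u: "{v, u} \<in> E" "u \<notin> ?S"
    using fresh_nbr[of v ?S] paths4_ends(2)[OF R] m_pos by auto
  have "c \<in> ?S" using R by (cases R) (auto simp: paths_def)
  then obtain P where P: "P \<in> paths 3 c u" "set P \<inter> ?S \<subseteq> {c, u}"
    using paths3_exists[of c u ?S] u edgeD[OF u(1)] paths4_ends[OF R] cS m_pos by auto
  have "c \<in> set R" "c \<in> set R'" "c \<in> set P"
    using R R' P(1) by (cases R; cases R'; cases P; auto simp: paths_def)+
  then have "set P \<inter> set R = {c}" "set P \<inter> set R' = {c}"
    using P(2) u(2) by auto
  from hspan_add[OF octagon_paths[OF P(1) R edge_sym[OF u(1)] this(1)]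
      octagon_paths[OF P(1) R' edge_sym[OF u(1)] this(2)]]
  show ?thesis by (simp add: add_ac)
qed

text \<open>
  Modulo \<open>hspan\<close>, an octagon through a fixed vertex \<open>c\<close> says that an edge \<open>uv\<close> is the sum of a
  3-path from \<open>c\<close> to \<open>u\<close> and a 4-path from \<open>c\<close> to \<open>v\<close>. The class of a 3-path depends only on its end,
  and 3-paths and 4-paths to the same vertex differ by a constant \<open>T\<close>.
\<close>

lemma edge_potential:
  assumes c: "c \<in> V"
  shows "\<exists>G T. \<forall>u v. {u, v} \<in> E \<longrightarrow> edge_fun u v + (G u + (G v + T)) \<in> hspan"
proof -
  \<comment> \<open>There is no such path from \<open>c\<close> to itself, so the values of
    \<open>g\<close> and \<open>h\<close> at \<open>c\<close> are arbitrary. This is why the vertex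
    \<open>c\<close> is excluded at first and receives its own value in \<open>G\<close>.\<close>
  define g where "g = (\<lambda>u. walk_sum (SOME P. P \<in> paths 3 c u))"
  define h where "h = (\<lambda>u. walk_sum (SOME P. P \<in> paths 4 c u))"
  define t where "t = (\<lambda>u. g u + h u)"
  have g: "g u + walk_sum P \<in> hspan" if "P \<in> paths 3 c u" for u P
    unfolding g_def using paths3_equiv[OF someI[of "\<lambda>P. P \<in> paths 3 c u"] that] that by blast
  have h: "h u + walk_sum P \<in> hspan" if "P \<in> paths 4 c u" for u P
    unfolding h_def using paths4_equiv[OF someI[of "\<lambda>P. P \<in> paths 4 c u"] that] that by blast
  have edge1: "g u + (h v + edge_fun u v) \<in> hspan" if uv: "{u, v} \<in> E" "u \<noteq> c" "v \<noteq> c" for u v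
  proof -
    have V: "u \<in> V" "v \<in> V" "u \<noteq> v" using edgeD[OF uv(1)] by auto
    obtain R where R: "R \<in> paths 4 c v" "set R \<inter> {u} \<subseteq> {c, v}"
      using paths4_exists[of c v "{u}"] c V uv m_pos by auto
    obtain P where P: "P \<in> paths 3 c u" "set P \<inter> set R \<subseteq> {c, u}"
      using paths3_exists[of c u "set R"] c V uv m_pos paths4_ends(4)[OF R(1)] by auto
    have "c \<in> set P" "c \<in> set R"
      using P(1) R(1) by (cases P; cases R; auto simp: paths_def)+
    then have "set P \<inter> set R = {c}" using P(2) R(2) uv V by auto
    from hspan_add[OF g[OF P(1)] hspan_add[OF h[OF R(1)] octagon_paths[OF P(1) R(1) uv(1) this]]]
    show ?thesis by (simp add: add_ac)
  qed
  \<comment> \<open>Adding \<open>edge1\<close> for both orientations of the edge cancels the edge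
    itself. As links avoiding \<open>c\<close> join any two other vertices, \<open>t\<close> is
    constant modulo \<open>hspan\<close>.\<close>
  have t_adj: "t u + t v \<in> hspan" if uv: "{u, v} \<in> E" "u \<noteq> c" "v \<noteq> c" for u v
  proof -
    from hspan_add[OF edge1[OF uv] edge1[OF edge_sym[OF uv(1)] uv(3,2)]]
    show ?thesis unfolding t_def by (simp add: add_ac insert_commute)
  qed
  have t_eq: "t u + t v \<in> hspan" if uv: "u \<in> V" "v \<in> V" "u \<noteq> c" "v \<noteq> c" for u v
  proof -
    obtain x y where xy: "{u, x} \<in> E" "{x, y} \<in> E" "{y, v} \<in> E" "x \<noteq> c" "y \<noteq> c"
      using link3[of u v "{c}"] uv m_pos by auto
    from hspan_add[OF t_adj[OF xy(1) uv(3) xy(4)] hspan_add[OF t_adj[OF xy(2,4,5)] t_adj[OF xy(3,5) uv(4)]]]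
    show ?thesis by (simp add: add_ac)
  qed
  obtain w0 where w0: "{c, w0} \<in> E"
    using fresh_nbr[OF c, of "{}"] m_pos by auto
  then have w0V: "w0 \<in> V" "w0 \<noteq> c" using edgeD by auto
  define T where "T = t w0"
  have edge2: "edge_fun u v + (g u + (g v + T)) \<in> hspan"
    if uv: "{u, v} \<in> E" "u \<noteq> c" "v \<noteq> c" for u v
  proof -
    have "t v + T \<in> hspan"
      unfolding T_def using uv w0V edgeD[OF uv(1)] by (intro t_eq) auto
    from hspan_add[OF edge1[OF uv] this] show ?thesis unfolding t_def by (simp add: add_ac)
  qed
  \<comment> \<open>In an octagon through \<open>c\<close>, \<open>w\<close> and \<open>w'\<close>,
    \<open>edge2\<close> covers the six edges that avoid \<open>c\<close>. The potentials of the
    inner vertices occur twice and \<open>T\<close> six times, so only the ends \<open>w\<close> and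
    \<open>w'\<close> remain.\<close>
  have centre: "edge_fun c w + (edge_fun c w' + (g w + g w')) \<in> hspan"
    if w: "{c, w} \<in> E" "{c, w'} \<in> E" "w \<noteq> w'" for w w'
  proof -
    have V: "w \<in> V" "w' \<in> V" "w \<noteq> c" "w' \<noteq> c" using w edgeD by auto
    have "card {c, w, w'} < 100 * m" using m_pos by (simp add: card_insert_if)
    then obtain z where z: "{c, z} \<in> E" "z \<notin> {c, w, w'}"
      using fresh_nbr[OF c, of "{c, w, w'}"] by auto
    have "z \<in> V" using edgeD[OF z(1)] by auto
    then obtain x1 y1 where p1: "{w, x1} \<in> E" "{x1, y1} \<in> E" "{y1, z} \<in> E" "x1 \<noteq> y1"
      "x1 \<notin> {w, z, c, w'}" "y1 \<notin> {w, z, c, w'}"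
      using link3[of w z "{c, w'}"] V z(2) m_pos by (auto simp: card_insert_if)
    have "card {c, w, x1, y1} \<le> 50 * m" using m_pos by (simp add: card_insert_if)
    then obtain x2 y2 where p2: "{z, x2} \<in> E" "{x2, y2} \<in> E" "{y2, w'} \<in> E" "x2 \<noteq> y2"
      "x2 \<notin> {z, w', c, w, x1, y1}" "y2 \<notin> {z, w', c, w, x1, y1}"
      using link3[of z w' "{c, w, x1, y1}"] V \<open>z \<in> V\<close> z(2) by auto
    have ne: "w \<noteq> c" "x1 \<noteq> c" "y1 \<noteq> c" "z \<noteq> c" "x2 \<noteq> c" "y2 \<noteq> c" "w' \<noteq> c"
      using p1 p2 z(2) V by auto
    have oct: "walk_sum [c, w, x1, y1, z, x2, y2, w', c] \<in> hspan"
      using w p1 p2 z(2) V by (intro octagon) (auto simp: insert_commute)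
    note hspan_add[OF oct hspan_add[OF edge2[OF p1(1) ne(1,2)] hspan_add[OF edge2[OF p1(2) ne(2,3)]
      hspan_add[OF edge2[OF p1(3) ne(3,4)] hspan_add[OF edge2[OF p2(1) ne(4,5)]
      hspan_add[OF edge2[OF p2(2) ne(5,6)] edge2[OF p2(3) ne(6,7)]]]]]]]
    then show ?thesis by (simp add: add_ac insert_commute)
  qed
  \<comment> \<open>The value at \<open>c\<close> is solved from the required equation for the edge
    from \<open>c\<close> to \<open>w0\<close>; \<open>centre\<close> transfers it to all other
    edges at \<open>c\<close>.\<close>
  define G where "G = (\<lambda>u. if u = c then edge_fun c w0 + (g w0 + T) else g u)"
  have Gc: "edge_fun c w + (G c + (G w + T)) \<in> hspan" if w: "{c, w} \<in> E" for w
  proof -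
    have "w \<noteq> c" using edgeD[OF w] by auto
    show ?thesis
    proof (cases "w = w0")
      case True
      then show ?thesis
        using \<open>w \<noteq> c\<close> span2.zero by (simp add: G_def add_ac hspan_def)
    next
      case False
      then show ?thesis
        using centre[OF w w0] \<open>w \<noteq> c\<close> by (simp add: G_def add_ac)
    qed
  qed
  have "edge_fun u v + (G u + (G v + T)) \<in> hspan" if uv: "{u, v} \<in> E" for u v
  proof -
    consider "u = c" | "v = c" | "u \<noteq> c" "v \<noteq> c" by blast
    then show ?thesis
    proof cases
      case 2
      then show ?thesis
        using Gc[of u] edge_sym[OF uv] by (simp add: insert_commute add_ac)
    qed (use uv Gc edge2 in \<open>auto simp: G_def\<close>)
  qed
  then show ?thesis by blast
qed

text \<open>Sum the relations of \<open>edge_potential\<close> over the edges of \<open>C\<close>.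
  Each \<open>G v\<close> occurs as often as the degree of \<open>v\<close>, and \<open>T\<close> as
  often as \<open>C\<close> has edges; both numbers are even, so only \<open>C\<close>
  survives.\<close>

lemma even_cycle_in_hspan:
  assumes C: "C \<subseteq> E" and even: "even (card C)" and deg: "\<And>v. even (edge_degree C v)"
  shows "char_vec C \<in> hspan"
proof (cases "C = {}")
  case True
  then show ?thesis by (simp add: hspan_def span2.zero)
next
  case False
  have finC: "finite C" using C finite_E finite_subset by blast
  have pair: "\<exists>u v. e = {u, v} \<and> u \<noteq> v \<and> u \<in> V \<and> v \<in> V" if "e \<in> C" for e
  proof -
    have "card e = 2" "e \<subseteq> V" using that C edges by (auto simp: complete_edges_def)
    then show ?thesis by (auto simp: card_2_iff)
  qed
  from False pair obtain c where "c \<in> V" by blast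
  then obtain G T where GT: "\<And>u v. {u, v} \<in> E \<Longrightarrow> edge_fun u v + (G u + (G v + T)) \<in> hspan"
    using edge_potential by blast
  have "char_vec {e} + ((\<Sum>v | v \<in> V \<and> v \<in> e. G v) + T) \<in> hspan" if e: "e \<in> C" for e
  proof -
    obtain u v where uv: "e = {u, v}" "u \<noteq> v" "u \<in> V" "v \<in> V" using pair[OF e] by blast
    then have "{w. w \<in> V \<and> w \<in> e} = {u, v}" by auto
    with uv GT[of u v] e C show ?thesis by (auto simp: add.assoc)
  qed
  then have "(\<Sum>e\<in>C. char_vec {e} + ((\<Sum>v | v \<in> V \<and> v \<in> e. G v) + T)) \<in> hspan"
    unfolding hspan_def by (rule span2_sum)
  also have "(\<Sum>e\<in>C. char_vec {e} + ((\<Sum>v | v \<in> V \<and> v \<in> e. G v) + T)) =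
      char_vec C + ((\<Sum>e\<in>C. \<Sum>v | v \<in> V \<and> v \<in> e. G v) + (\<Sum>e\<in>C. T))"
    by (simp only: sum.distrib char_vec_eq_sum[OF finC])
  also have "(\<Sum>e\<in>C. T) = 0" using even by (rule bit_fun_sum_const_even)
  also have "(\<Sum>e\<in>C. \<Sum>v | v \<in> V \<and> v \<in> e. G v) = (\<Sum>v\<in>V. \<Sum>e | e \<in> C \<and> v \<in> e. G v)"
    by (rule sum.swap_restrict[OF finC finite_V])
  also have "\<dots> = 0"
    using deg by (intro sum.neutral ballI bit_fun_sum_const_even) (simp add: edge_degree_def)
  finally show ?thesis unfolding add_0_right .
qed

end

section \<open>The cycle space modulo the Hamilton circuits\<close>

text \<open>Suited to a quotient known to have exactly two elements: the nonzero one generates,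
  while the empty set spans only zero.\<close>

lemma (in vectorspace) dim_eq_1:
  assumes "carrier V = {\<zero>\<^bsub>V\<^esub>, x}" and "x \<noteq> \<zero>\<^bsub>V\<^esub>"
  shows "dim = 1"
  unfolding dim_def
proof (rule Least_equality)
  have x: "{x} \<subseteq> carrier V" using assms(1) by auto
  have sub: "submodule K (span {x}) V" using span_is_submodule[OF x] .
  have "x \<in> span {x}" using in_own_span[OF x] by auto
  moreover have "\<zero>\<^bsub>V\<^esub> \<in> span {x}" using sub by (auto simp: submodule_def)
  moreover have "span {x} \<subseteq> carrier V" using span_is_subset2[OF x] .
  ultimately have "gen_set {x}" using assms(1) by auto
  then show "\<exists>A. finite A \<and> card A = 1 \<and> A \<subseteq> carrier V \<and> gen_set A"
    using x by (intro exI[of _ "{x}"]) auto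
next
  fix k assume "\<exists>A. finite A \<and> card A = k \<and> A \<subseteq> carrier V \<and> gen_set A"
  then obtain A where A: "finite A" "card A = k" "gen_set A" by blast
  show "1 \<le> k"
  proof (rule ccontr)
    assume "\<not> 1 \<le> k"
    then have "card A = 0" using A(2) by simp
    then have "A = {}" using A(1) by simp
    moreover have "span {} = {\<zero>\<^bsub>V\<^esub>}" by (auto simp: span_def lincomb_def)
    ultimately show False using A(3) assms by auto
  qed
qed

lemma edge_vec_restrict: "edge_vec E C = restrict (char_vec C) E"
  by (auto simp: edge_vec_def char_vec_def fun_eq_iff)

text \<open>Bridge from total functions to the library's module of extensional functions:
  restriction to \<open>E\<close> respects addition and sends \<open>char_vec\<close> to
  \<open>edge_vec\<close>.\<close>

lemma restrict_span2_F2_span: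
  assumes "f \<in> span2 (char_vec ` S)"
  shows "restrict f E \<in> F2_span E S"
proof -
  interpret vectorspace F2 "edge_space E" by (rule edge_space_vectorspace)
  have gen: "edge_vec E ` S \<subseteq> carrier (edge_space E)"
    by (auto simp: edge_space_simps edge_vec_def)
  have sub: "submodule F2 (F2_span E S) (edge_space E)"
    unfolding F2_span_def using span_is_submodule[OF gen] .
  from assms show ?thesis
  proof (induction rule: span2.induct)
    case zero
    have "restrict 0 E = \<zero>\<^bsub>edge_space E\<^esub>" by (auto simp: edge_space_simps)
    then show ?case using sub by (simp only: submodule_def)
  next
    case (add a b)
    then have "restrict a E \<in> F2_span E S"
      using in_own_span[OF gen] by (auto simp: F2_span_def edge_vec_restrict)
    then have "restrict a E \<oplus>\<^bsub>edge_space E\<^esub> restrict b E \<in> F2_span E S"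
      using add.IH by (rule submodule.m_closed[OF sub])
    also have "restrict a E \<oplus>\<^bsub>edge_space E\<^esub> restrict b E = restrict (a + b) E"
      by (auto simp: edge_space_simps plus_fun_apply fun_eq_iff)
    finally show ?case .
  qed
qed

lemma cycle_space_eq_edge_vec:
  assumes "f \<in> cycle_space E"
  shows "f = edge_vec E {e \<in> E. f e = 1}"
  using assms by (auto simp: cycle_space_def edge_space_simps edge_vec_def fun_eq_iff extensional_def PiE_def)

text \<open>The coordinate sum is the linear functional that records the parity of the number of
  edges; it separates the even part of the cycle space from the rest.\<close>

lemma sum_edge_vec:
  assumes "finite E" "C \<subseteq> E"
  shows "(\<Sum>e\<in>E. edge_vec E C e) = 0 \<longleftrightarrow> even (card C)"
proof -
  have "{e \<in> E. edge_vec E C e = 1} = C"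
    using assms(2) by (auto simp: edge_vec_def split: if_splits)
  then show ?thesis using even_card_ones_iff[OF assms(1), of "edge_vec E C"] by simp
qed

text \<open>The kernel of the coordinate sum is a submodule that contains all generators. For even
  \<open>n\<close> this is the obstruction to generating the cycle space by Hamilton
  circuits.\<close>

lemma F2_span_even:
  assumes E: "finite E" and S: "S \<subseteq> circuits E" and even: "\<And>C. C \<in> S \<Longrightarrow> even (card C)"
    and f: "f \<in> F2_span E S"
  shows "sum f E = 0"
proof -
  interpret vectorspace F2 "edge_space E" by (rule edge_space_vectorspace)
  define K where "K = {f \<in> carrier (edge_space E). sum f E = 0}"
  have "submodule F2 K (edge_space E)"
  proof
    show "K \<subseteq> carrier (edge_space E)" by (auto simp: K_def)
    show "f \<oplus>\<^bsub>edge_space E\<^esub> g \<in> K" if "f \<in> K" "g \<in> K" for f g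
      using that by (simp add: K_def edge_space_simps sum.distrib del: add_bit_eq_xor)
    show "\<zero>\<^bsub>edge_space E\<^esub> \<in> K" by (simp add: K_def edge_space_simps)
    show "c \<odot>\<^bsub>edge_space E\<^esub> f \<in> K" if "c \<in> carrier F2" "f \<in> K" for c f
      using that by (simp add: K_def edge_space_simps del: mult_bit_eq_and flip: sum_distrib_left)
  qed
  moreover have "edge_vec E ` S \<subseteq> K"
  proof
    fix g assume "g \<in> edge_vec E ` S"
    then obtain C where "C \<in> S" "g = edge_vec E C" by blast
    then show "g \<in> K"
      using sum_edge_vec[OF E, of C] even S
      by (auto simp: K_def edge_space_simps edge_vec_def circuits_def)
  qed
  ultimately have "F2_span E S \<subseteq> K"
    unfolding F2_span_def by (rule span_is_subset[rotated])
  with f show ?thesis by (auto simp: K_def)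
qed

text \<open>Double counting of incidences: every vertex lies on two edges and every edge has two
  ends.\<close>

lemma card_hamilton_circuit:
  assumes "finite V" "C \<in> hamilton_circuits V E"
  shows "card C = card V"
proof -
  have C: "finite C" "\<forall>e\<in>C. card e = 2" "\<forall>v\<in>V. edge_degree C v = 2" "\<Union>C = V"
    using assms(2) by (auto simp: hamilton_circuits_def circuits_def circuit_def)
  have "(\<Sum>v\<in>V. card {e \<in> C. v \<in> e}) = sum (\<lambda>_. 2) C"
  proof (rule sum_multicount_gen[OF assms(1) C(1)], intro ballI)
    fix e assume "e \<in> C"
    then have "{v \<in> V. v \<in> e} = e" using C(4) by auto
    then show "card {v \<in> V. v \<in> e} = 2" using C(2) \<open>e \<in> C\<close> by simp
  qed
  moreover have "(\<Sum>v\<in>V. card {e \<in> C. v \<in> e}) = (\<Sum>v\<in>V. 2)"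
    using C(3) by (intro sum.cong) (auto simp: edge_degree_def)
  ultimately show ?thesis by simp
qed

section \<open>Parity and the span of the Hamilton circuits\<close>

context dense_expander
begin

lemma card_V_ge:
  assumes "v \<in> V" shows "card V \<ge> 100"
proof -
  have "card (nbrs v) \<ge> 100 * m" using min_degree[OF assms] by (simp add: nbrs_def)
  moreover have "card (nbrs v) \<le> card V" using nbrs_V finite_V by (rule card_mono[rotated])
  ultimately show ?thesis using m_pos by linarith
qed

text \<open>An edge \<open>st\<close> inside \<open>U\<close> closes a Hamilton path of
  \<open>U\<close> from \<open>s\<close> to \<open>t\<close>. This provides circuits of length
  \<open>n\<close> and, after removing one vertex, \<open>n - 1\<close>.\<close>

lemma circuit_spanning:
  assumes "U \<subseteq> V" "card (V - U) \<le> 1" "V \<noteq> {}"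
  shows "\<exists>C\<in>circuits E. card C = card U \<and> \<Union>C = U"
proof -
  obtain v where "v \<in> V" using assms(3) by blast
  then have cV: "card V \<ge> 100" by (rule card_V_ge)
  have "card U + card (V - U) = card V"
    using card_Diff_subset[of U V] card_mono[OF finite_V assms(1)] finite_subset[OF assms(1) finite_V] assms(1)
    by simp
  then have cU: "card U \<ge> 3" using cV assms(2) by linarith
  then obtain s where s: "s \<in> U" by fastforce
  have "card (V - U) < 100 * m" using assms(2) m_pos by linarith
  then obtain t where t: "{s, t} \<in> E" "t \<notin> V - U"
    using fresh_nbr[of s "V - U"] s assms(1) finite_V by auto
  have t': "t \<in> U" "s \<noteq> t" using edgeD[OF t(1)] t(2) by auto
  obtain xs where xs: "is_path xs" "xs \<noteq> []" "hd xs = s" "last xs = t" "set xs = U"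
    using hamilton_path[OF assms(1) _ s t'] assms(2) m_pos by auto
  have "length xs = card U" using xs(1,5) distinct_card[of xs] by (simp add: is_path_def)
  then show ?thesis
    using circuit_list[of xs] card_circuit_edges[of xs] Union_circuit_edges[of xs] xs t cU
    by (intro bexI[of _ "circuit_edges xs"]) (auto simp: is_path_def insert_commute)
qed

lemma even_cycle_in_F2_span:
  assumes f: "f \<in> cycle_space E" "sum f E = 0" and S: "hamilton_circuits V E \<subseteq> S"
  shows "f \<in> F2_span E S"
proof -
  define C where "C = {e \<in> E. f e = 1}"
  have "f = restrict (char_vec C) E"
    using cycle_space_eq_edge_vec[OF f(1)] by (simp add: edge_vec_restrict C_def)
  moreover have "char_vec C \<in> hspan"
  proof (rule even_cycle_in_hspan)
    show "even (card C)" using even_card_ones_iff[OF finite_E, of f] f(2) by (simp add: C_def)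
    show "even (edge_degree C v)" for v using f(1) by (simp add: cycle_space_def C_def)
  qed (auto simp: C_def)
  then have "char_vec C \<in> span2 (char_vec ` S)"
  proof -
    have "a \<in> span2 A \<Longrightarrow> A \<subseteq> B \<Longrightarrow> a \<in> span2 B" for a and A B :: "('a set \<Rightarrow> bit) set"
      by (induction rule: span2.induct) (auto intro: span2.intros)
    then show ?thesis using \<open>char_vec C \<in> hspan\<close> S unfolding hspan_def by blast
  qed
  ultimately show ?thesis using restrict_span2_F2_span by metis
qed

text \<open>Even elements are already sums of Hamilton circuits; adding the odd circuit
  \<open>C\<close> makes an odd element even.\<close>

lemma F2_span_eq_cycle_space:
  assumes S: "hamilton_circuits V E \<subseteq> S" "S \<subseteq> circuits E" and C: "C \<in> S" "odd (card C)"
  shows "F2_span E S = cycle_space E"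
proof
  have sub: "subspace F2 (F2_span E S) (edge_space E\<lparr>carrier := cycle_space E\<rparr>)"
    by (rule F2_span_circuits_subspace[OF finite_E S(2)])
  then show "F2_span E S \<subseteq> cycle_space E"
    by (auto simp: VectorSpace.subspace_def submodule_def)
  have CE: "C \<in> circuits E" "C \<subseteq> E" using C(1) S(2) by (auto simp: circuits_def)
  have mem: "edge_vec E C \<in> F2_span E S"
    using restrict_span2_F2_span[of "char_vec C" S E] C(1) by (auto simp: edge_vec_restrict intro: span2_base)
  have "sum (edge_vec E C) E = 1"
    using sum_edge_vec[OF finite_E CE(2)] C(2) by auto
  show "cycle_space E \<subseteq> F2_span E S"
  proof
    fix f assume f: "f \<in> cycle_space E"
    show "f \<in> F2_span E S"
    proof (cases "sum f E = 0")
      case True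
      then show ?thesis using even_cycle_in_F2_span[OF f] S(1) by blast
    next
      case False
      define g where "g = f \<oplus>\<^bsub>edge_space E\<^esub> edge_vec E C"
      have "g \<in> cycle_space E"
        using cycle_space_subspace[OF finite_E] f circuit_in_cycle_space[OF CE(1)]
        by (auto simp: g_def VectorSpace.subspace_def submodule_def)
      moreover have "sum g E = sum f E + sum (edge_vec E C) E"
        by (simp add: g_def edge_space_simps sum.distrib del: add_bit_eq_xor)
      then have "sum g E = 0"
        using False \<open>sum (edge_vec E C) E = 1\<close> by simp
      ultimately have "g \<in> F2_span E S" using even_cycle_in_F2_span S(1) by blast
      then have "g \<oplus>\<^bsub>edge_space E\<^esub> edge_vec E C \<in> F2_span E S"
        using mem sub by (simp add: VectorSpace.subspace_def submodule_def)
      also have "g \<oplus>\<^bsub>edge_space E\<^esub> edge_vec E C = f"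
        using f by (auto simp: g_def edge_space_simps cycle_space_def fun_eq_iff PiE_def extensional_def)
      finally show ?thesis .
    qed
  qed
qed

text \<open>Hamilton circuits are now even, so their span is exactly the kernel of the coordinate
  sum on the cycle space. A circuit missing one vertex is odd, so that functional is onto and the
  quotient has two elements.\<close>

lemma hamilton_quotient_dim:
  assumes even: "even (card V)" and "V \<noteq> {}"
  shows "vectorspace.dim F2
    (quotient_space (edge_space E\<lparr>carrier := cycle_space E\<rparr>) (F2_span E (hamilton_circuits V E))) = 1"
proof -
  let ?H = "hamilton_circuits V E"
  let ?U = "F2_span E ?H"
  let ?Z = "edge_space E\<lparr>carrier := cycle_space E\<rparr>"
  have H: "?H \<subseteq> circuits E" by (auto simp: hamilton_circuits_def)
  interpret Q: vectorspace F2 "quotient_space ?Z ?U"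
    by (rule cycle_space_quotient_vectorspace[OF finite_E H])
  have sub: "subspace F2 (cycle_space E) (edge_space E)" by (rule cycle_space_subspace[OF finite_E])
  have UZ: "?U \<subseteq> cycle_space E"
    using F2_span_circuits_subspace[OF finite_E H] by (auto simp: VectorSpace.subspace_def submodule_def)
  have U: "?U = {f \<in> cycle_space E. sum f E = 0}"
    using even_cycle_in_F2_span[of _ ?H] F2_span_even[OF finite_E H] UZ
      card_hamilton_circuit[OF finite_V] even by auto
  \<comment> \<open>The cosets of the kernel are the level sets of the coordinate sum.\<close>
  have coset: "?U +>\<^bsub>?Z\<^esub> x = {f \<in> cycle_space E. sum f E = sum x E}" if x: "x \<in> cycle_space E" for x
  proof -
    have add: "f \<oplus>\<^bsub>edge_space E\<^esub> x \<in> cycle_space E" if "f \<in> cycle_space E" for f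
      using sub that x by (auto simp: VectorSpace.subspace_def submodule_def)
    have sum: "sum (f \<oplus>\<^bsub>edge_space E\<^esub> x) E = sum f E + sum x E" for f
      by (simp add: edge_space_simps sum.distrib del: add_bit_eq_xor)
    have cancel: "f = (f \<oplus>\<^bsub>edge_space E\<^esub> x) \<oplus>\<^bsub>edge_space E\<^esub> x" if "f \<in> cycle_space E" for f
      using that by (auto simp: edge_space_simps cycle_space_def fun_eq_iff PiE_def extensional_def)
    have "?U +>\<^bsub>?Z\<^esub> x = (\<lambda>f. f \<oplus>\<^bsub>edge_space E\<^esub> x) ` {f \<in> cycle_space E. sum f E = 0}"
      by (auto simp: a_r_coset_def' U)
    also have "\<dots> = {f \<in> cycle_space E. sum f E = sum x E}"
    proof (intro equalityI subsetI)
      fix f assume "f \<in> {f \<in> cycle_space E. sum f E = sum x E}"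
      then have "f \<oplus>\<^bsub>edge_space E\<^esub> x \<in> {f \<in> cycle_space E. sum f E = 0}"
        using add sum by simp
      then show "f \<in> (\<lambda>f. f \<oplus>\<^bsub>edge_space E\<^esub> x) ` {f \<in> cycle_space E. sum f E = 0}"
        using cancel[of f] \<open>f \<in> _\<close> by blast
    qed (auto simp: add sum simp del: add_bit_eq_xor)
    finally show ?thesis .
  qed
  obtain v where v: "v \<in> V" using assms(2) by blast
  then obtain C where C: "C \<in> circuits E" "card C = card (V - {v})"
    using circuit_spanning[of "V - {v}"] finite_V by (auto simp: double_diff)
  have "odd (card C)"
  proof -
    have "card C = card V - 1" using v finite_V C(2) by simp
    with even card_V_ge[OF v] show ?thesis by presburger
  qed
  then have t: "edge_vec E C \<in> cycle_space E" "sum (edge_vec E C) E = 1"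
    using circuit_in_cycle_space[OF C(1)] sum_edge_vec[OF finite_E, of C] C(1)
    by (auto simp: circuits_def)
  define X where "X = {f \<in> cycle_space E. sum f E = 1}"
  have "carrier (quotient_space ?Z ?U) = (\<lambda>x. {f \<in> cycle_space E. sum f E = sum x E}) ` cycle_space E"
    using coset by (auto simp: quotient_space_def A_RCOSETS_def')
  also have "\<dots> = {?U, X}"
  proof (intro equalityI subsetI)
    fix A assume "A \<in> {?U, X}"
    moreover have "?U = {f \<in> cycle_space E. sum f E = sum (\<zero>\<^bsub>edge_space E\<^esub>) E}"
      unfolding U by (simp add: edge_space_simps)
    moreover have "\<zero>\<^bsub>edge_space E\<^esub> \<in> cycle_space E"
      using sub by (simp add: VectorSpace.subspace_def submodule_def)
    ultimately show "A \<in> (\<lambda>x. {f \<in> cycle_space E. sum f E = sum x E}) ` cycle_space E"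
      using t unfolding X_def by auto
  qed (auto simp: U X_def)
  finally have "carrier (quotient_space ?Z ?U) = {\<zero>\<^bsub>quotient_space ?Z ?U\<^esub>, X}"
    by (simp add: quotient_space_def)
  moreover have "X \<noteq> \<zero>\<^bsub>quotient_space ?Z ?U\<^esub>"
  proof -
    have "edge_vec E C \<in> X" "edge_vec E C \<notin> ?U" using t by (simp_all add: X_def U)
    then show ?thesis by (simp add: quotient_space_def) blast
  qed
  ultimately show ?thesis by (rule Q.dim_eq_1)
qed

lemma hamilton_span:
  assumes "V \<noteq> {}" and n: "n = card V"
  shows "F2_span E {C \<in> circuits E. card C = n \<or> card C = n - 1} = cycle_space E"
    and "even n \<Longrightarrow> vectorspace.dim F2
      (quotient_space (edge_space E\<lparr>carrier := cycle_space E\<rparr>) (F2_span E (hamilton_circuits V E))) = 1"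
    and "odd n \<Longrightarrow> F2_span E (hamilton_circuits V E) = cycle_space E"
proof -
  let ?S = "{C \<in> circuits E. card C = n \<or> card C = n - 1}"
  obtain v where v: "v \<in> V" using assms(1) by blast
  obtain C where C: "C \<in> circuits E" "card C = n - 1"
    using circuit_spanning[of "V - {v}"] v finite_V n by (auto simp: double_diff)
  obtain C' where C': "C' \<in> circuits E" "card C' = n" "\<Union>C' = V"
    using circuit_spanning[of V] v n by auto
  \<comment> \<open>One of \<open>n\<close> and \<open>n - 1\<close> is odd; the bound excludes
    \<open>n = 0\<close>, where truncated subtraction would spoil this.\<close>
  have "n \<ge> 100" using card_V_ge[OF v] n by simp
  then have "\<exists>C\<in>?S. odd (card C)"
    using C C' by (cases "even n") auto
  moreover have "hamilton_circuits V E \<subseteq> ?S"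
    using card_hamilton_circuit[OF finite_V] n by (auto simp: hamilton_circuits_def)
  ultimately show "F2_span E ?S = cycle_space E"
    using F2_span_eq_cycle_space[of ?S] by auto
  show "F2_span E (hamilton_circuits V E) = cycle_space E" if "odd n"
    using that C' F2_span_eq_cycle_space[of "hamilton_circuits V E" C']
    by (auto simp: hamilton_circuits_def)
qed (use hamilton_quotient_dim assms in auto)

end

section \<open>The random graph\<close>

definition no_edges_between :: "'a set \<Rightarrow> 'a set \<Rightarrow> 'a set set set"
  where "no_edges_between A B = {E. \<forall>a\<in>A. \<forall>b\<in>B. {a, b} \<notin> E}"

lemma finite_complete_edges: "finite V \<Longrightarrow> finite (complete_edges V)"
  by (rule finite_subset[of _ "Pow V"]) (auto simp: complete_edges_def)

text \<open>The event is a product event: coordinates in \<open>F\<close> are forced to be false and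
  the others are free.\<close>

lemma prob_disjoint:
  assumes "F \<subseteq> complete_edges {1..n}" and p: "p \<in> {0..1}"
  shows "measure_pmf.prob (random_graph n p) {E. E \<inter> F = {}} = (1 - p) ^ card F"
proof -
  let ?K = "complete_edges {1..n}"
  have fin: "finite ?K" by (simp add: finite_complete_edges)
  have "(\<lambda>f. {e \<in> ?K. f e}) -` {E. E \<inter> F = {}} = Pi ?K (\<lambda>e. if e \<in> F then {False} else UNIV)"
    using assms(1) by (auto simp: Pi_def)
  then have "measure_pmf.prob (random_graph n p) {E. E \<inter> F = {}} =
      (\<Prod>e\<in>?K. measure_pmf.prob (bernoulli_pmf p) (if e \<in> F then {False} else UNIV))"
    by (simp only: random_graph_def measure_map_pmf measure_Pi_pmf_Pi[OF fin])
  also have "\<dots> = (\<Prod>e\<in>?K. if e \<in> F then 1 - p else 1)"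
    using p by (intro prod.cong) (auto simp: measure_pmf_single)
  also have "\<dots> = (\<Prod>e\<in>?K \<inter> F. 1 - p)"
    by (rule prod.inter_restrict[OF fin, symmetric])
  also have "?K \<inter> F = F" using assms(1) by blast
  finally show ?thesis by simp
qed

text \<open>All \<open>card A * card B\<close> possible edges are absent independently, and
  \<open>1 - p\<close> is at most \<open>exp (- p)\<close>. The lower bounds \<open>q\<close> and
  \<open>k\<close> give a form uniform over each union bound below.\<close>

lemma prob_no_edges_between:
  assumes AB: "A \<subseteq> {1..n}" "B \<subseteq> {1..n}" "A \<inter> B = {}" and p: "p \<in> {0..1}"
    and q: "0 \<le> q" "q \<le> p" and k: "k \<le> real (card A * card B)"
  shows "measure_pmf.prob (random_graph n p) (no_edges_between A B) \<le> exp (- (q * k))"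
proof -
  define F where "F = (\<lambda>(a, b). {a, b}) ` (A \<times> B)"
  have "F \<subseteq> complete_edges {1..n}"
    using AB by (auto simp: F_def complete_edges_def card_insert_if)
  moreover have "no_edges_between A B = {E. E \<inter> F = {}}"
    by (auto simp: no_edges_between_def F_def)
  moreover have "card F = card A * card B"
    unfolding F_def card_cartesian_product[symmetric]
    using AB(3) by (intro card_image) (auto simp: inj_on_def doubleton_eq_iff)
  ultimately have "measure_pmf.prob (random_graph n p) (no_edges_between A B) = (1 - p) ^ (card A * card B)"
    using prob_disjoint[of F n p] p by simp
  also have "\<dots> \<le> exp (- p) ^ (card A * card B)"
    using p exp_ge_add_one_self[of "- p"] by (intro power_mono) auto
  also have "\<dots> = exp (- (p * real (card A * card B)))"
    by (simp flip: exp_of_nat_mult add: mult_ac)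
  also have "\<dots> \<le> exp (- (q * k))"
  proof -
    have "q * k \<le> q * real (card A * card B)" using q k by (intro mult_left_mono)
    also have "\<dots> \<le> p * real (card A * card B)" using q by (intro mult_right_mono) auto
    finally show ?thesis by simp
  qed
  finally show ?thesis .
qed

lemma card_subsets_le:
  assumes "finite V" shows "card {A. A \<subseteq> V \<and> card A = k} \<le> card V ^ k"
  using n_subsets[OF assms, of k] binomial_le_pow[of k "card V"]
  by (cases "k \<le> card V") (auto simp: binomial_eq_0)

text \<open>A union bound over two kinds of failure: an empty pair of disjoint
  \<open>m\<close>-sets, or a vertex \<open>v\<close> whose neighbours all lie in a set
  \<open>T\<close> of \<open>100 * m\<close> vertices.\<close>

lemma prob_not_dense_expander:
  assumes p: "p \<in> {0..1}" and q: "0 \<le> q" "q \<le> p" and m: "m \<ge> 1" "100 * m + 1 \<le> n"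
  shows "measure_pmf.prob (random_graph n p) {E. \<not> dense_expander {1..n} E m} \<le>
    real n ^ (2 * m) * exp (- (q * (real m * real m))) +
    real n ^ (100 * m + 1) * exp (- (q * (real n - 1 - 100 * real m)))"
proof -
  let ?P = "measure_pmf.prob (random_graph n p)"
  define S where "S = (\<lambda>k. {A. A \<subseteq> {1..n} \<and> card A = k})"
  have finS: "finite (S k)" for k by (rule finite_subset[of _ "Pow {1..n}"]) (auto simp: S_def)
  have cardS: "real (card (S k)) \<le> real n ^ k" for k
    using card_subsets_le[of "{1..n}" k] by (simp add: S_def flip: of_nat_power)
  define I1 where "I1 = {(A, B) \<in> S m \<times> S m. A \<inter> B = {}}"
  define I2 where "I2 = {1..n} \<times> S (100 * m)"
  define b1 where "b1 = exp (- (q * (real m * real m)))"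
  define b2 where "b2 = exp (- (q * (real n - 1 - 100 * real m)))"
  have fin: "finite I1" "finite I2"
    using finite_subset[of I1 "S m \<times> S m"] by (auto simp: I1_def I2_def finS)
  have "real (card I1) \<le> real (card (S m \<times> S m))"
    using finS by (intro of_nat_mono card_mono) (auto simp: I1_def)
  also have "\<dots> \<le> real n ^ m * real n ^ m"
    using cardS[of m] by (auto simp: card_cartesian_product intro!: mult_mono)
  finally have c1: "real (card I1) \<le> real n ^ (2 * m)" by (simp add: mult_2 power_add)
  have c2: "real (card I2) \<le> real n ^ (100 * m + 1)"
    using cardS[of "100 * m"] by (auto simp: I2_def card_cartesian_product intro!: mult_left_mono)
  let ?B1 = "\<Union>(A, B)\<in>I1. no_edges_between A B"
  let ?B2 = "\<Union>(v, T)\<in>I2. no_edges_between {v} ({1..n} - {v} - T)"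
  \<comment> \<open>The locale requires \<open>E\<close> to consist of edges on
    \<open>{1..n}\<close>, which holds on the support of the distribution.\<close>
  have "?P {E. \<not> dense_expander {1..n} E m} =
      ?P ({E. \<not> dense_expander {1..n} E m} \<inter> set_pmf (random_graph n p))"
    by (rule measure_Int_set_pmf[symmetric])
  also have "\<dots> \<le> ?P (?B1 \<union> ?B2)"
  proof (rule measure_pmf.finite_measure_mono)
    show "{E. \<not> dense_expander {1..n} E m} \<inter> set_pmf (random_graph n p) \<subseteq> ?B1 \<union> ?B2"
    proof (rule subsetI, rule ccontr)
      fix E assume E: "E \<in> {E. \<not> dense_expander {1..n} E m} \<inter> set_pmf (random_graph n p)"
        and good: "E \<notin> ?B1 \<union> ?B2"
      have EK: "E \<subseteq> complete_edges {1..n}" using E by (auto simp: random_graph_def)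
      have "dense_expander {1..n} E m"
      proof
        fix A B assume "A \<subseteq> {1..n}" "B \<subseteq> {1..n}" "A \<inter> B = {}" "card A = m" "card B = m"
        then have "(A, B) \<in> I1" by (auto simp: I1_def S_def)
        then show "\<exists>a\<in>A. \<exists>b\<in>B. {a, b} \<in> E"
          using good by (auto simp: no_edges_between_def)
      next
        fix v assume v: "v \<in> {1..n}"
        show "100 * m \<le> card {u. {u, v} \<in> E}"
        proof (rule ccontr)
          assume "\<not> 100 * m \<le> card {u. {u, v} \<in> E}"
          moreover have "{u. {u, v} \<in> E} \<subseteq> {1..n}"
            using EK by (auto simp: complete_edges_def)
          \<comment> \<open>A too small neighbourhood is padded to exactly \<open>100 * m\<close>
            vertices, so that \<open>T\<close> belongs to the index set of the union bound.\<close>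
          ultimately obtain T where T: "{u. {u, v} \<in> E} \<subseteq> T" "T \<subseteq> {1..n}" "card T = 100 * m"
            using exists_subset_between[of "{u. {u, v} \<in> E}" "100 * m" "{1..n}"] m by auto
          then have "(v, T) \<in> I2" using v by (auto simp: I2_def S_def)
          moreover have "E \<in> no_edges_between {v} ({1..n} - {v} - T)"
            using T(1) by (auto simp: no_edges_between_def insert_commute)
          ultimately show False using good by blast
        qed
      qed (use EK m in auto)
      with E show False by simp
    qed
  qed simp
  also have "\<dots> \<le> ?P ?B1 + ?P ?B2" by (rule measure_Un_le) auto
  also have "?P ?B1 \<le> (\<Sum>(A, B)\<in>I1. ?P (no_edges_between A B))"
    using measure_UNION_le[OF fin(1), of "\<lambda>(A, B). no_edges_between A B" "random_graph n p"]
    by (simp add: case_prod_unfold)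
  also have "\<dots> \<le> (\<Sum>x\<in>I1. b1)"
    unfolding b1_def using p q
    by (intro sum_mono) (auto simp: I1_def S_def intro!: prob_no_edges_between)
  also have "\<dots> \<le> real n ^ (2 * m) * b1"
    using c1 by (simp add: b1_def mult_right_mono)
  also have "?P ?B2 \<le> (\<Sum>(v, T)\<in>I2. ?P (no_edges_between {v} ({1..n} - {v} - T)))"
    using measure_UNION_le[OF fin(2), of "\<lambda>(v, T). no_edges_between {v} ({1..n} - {v} - T)" "random_graph n p"]
    by (simp add: case_prod_unfold)
  also have "\<dots> \<le> (\<Sum>x\<in>I2. b2)"
  proof (intro sum_mono)
    fix x assume "x \<in> I2"
    then obtain v T where x: "x = (v, T)" "v \<in> {1..n}" "T \<subseteq> {1..n}" "card T = 100 * m"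
      by (auto simp: I2_def S_def)
    have "card ({1..n} - {v} - T) \<ge> card ({1..n} - {v}) - card T"
      using x(3) by (intro diff_card_le_card_Diff) (auto intro: finite_subset)
    then have "card ({1..n} - {v} - T) \<ge> n - 1 - 100 * m" using x by simp
    then have "real n - 1 - 100 * real m \<le> real (card {v} * card ({1..n} - {v} - T))"
      using m by (simp add: of_nat_diff)
    then show "(case x of (v, T) \<Rightarrow> ?P (no_edges_between {v} ({1..n} - {v} - T))) \<le> b2"
      using x p q unfolding b2_def by (auto intro!: prob_no_edges_between)
  qed
  also have "\<dots> \<le> real n ^ (100 * m + 1) * b2"
    using c2 by (simp add: b2_def mult_right_mono)
  finally show ?thesis by (simp add: b1_def b2_def)
qed

text \<open>
  Here \<open>m\<close> is about \<open>n powr (1/2 - d/2)\<close>: then \<open>p * m\<close> dominates \<open>ln n\<close>, which excludes holes, and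
  \<open>m * ln n\<close> is dominated by \<open>p * n\<close>, which excludes small degrees.
\<close>

lemma prob_dense_expander_ge:
  fixes n :: nat and d p :: real
  defines "m \<equiv> nat \<lceil>real n powr (1 / 2 - d / 2)\<rceil>"
    and "L1 \<equiv> 2 * ln (real n) - real n powr (d / 2)"
    and "L2 \<equiv> 201 * ln (real n) - real n powr (3 * d / 2) / 2"
  assumes d: "0 < d" "d \<le> 1" and n: "n \<ge> 1" "101 + 100 * real n powr (1 / 2) \<le> real n / 2"
    and L: "L1 \<le> 0" "L2 \<le> 0" and p: "p \<in> {0..1}" "real n powr (- 1 / 2 + d) \<le> p"
  shows "measure_pmf.prob (random_graph n p) {E. dense_expander {1..n} E m} \<ge> 1 - (exp L1 + exp L2)"
proof -
  define a q where "a = real n powr (1 / 2 - d / 2)" and "q = real n powr (- 1 / 2 + d)"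
  have a1: "a \<ge> 1" using d n by (simp add: a_def ge_one_powr_ge_zero)
  have m: "a \<le> real m" "real m \<le> a + 1" "m \<ge> 1"
    using a1 unfolding m_def a_def[symmetric] by linarith+
  have "a \<le> real n powr (1 / 2)" unfolding a_def using d n by (intro powr_mono) auto
  then have half: "101 + 100 * a \<le> real n / 2" using n(2) by linarith
  have q0: "q \<ge> 0" by (simp add: q_def)
  have qa: "q * a = real n powr (d / 2)"
    using n by (simp add: q_def a_def field_simps flip: powr_add)
  have qn: "q * real n = a * real n powr (3 * d / 2)"
  proof -
    have "q * real n = q * real n powr 1" using n by simp
    also have "\<dots> = real n powr (1 / 2 + d)" 
      unfolding q_def powr_add[symmetric] by (rule arg_cong[of _ _ "(powr) (real n)"]) simp
    also have "\<dots> = a * real n powr (3 * d / 2)"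
      unfolding a_def powr_add[symmetric]
      by (rule arg_cong[of _ _ "(powr) (real n)"]) (simp add: field_simps)
    finally show ?thesis .
  qed
  have ln0: "ln (real n) \<ge> 0" using n by simp
  have pow: "real n ^ k = exp (real k * ln (real n))" for k
    using n by (simp add: exp_of_nat_mult)
  have t1: "real n ^ (2 * m) * exp (- (q * (real m * real m))) \<le> exp L1"
  proof -
    have "q * a \<le> q * real m" using m(1) q0 by (rule mult_left_mono)
    then have "2 * ln (real n) - q * real m \<le> L1" by (simp add: L1_def qa)
    then have "real m * (2 * ln (real n) - q * real m) \<le> real m * L1"
      by (intro mult_left_mono) auto
    \<comment> \<open>As \<open>L1\<close> is at most 0 and \<open>m\<close> at least 1, the factor
      \<open>m\<close> only decreases the exponent.\<close>
    also have "\<dots> \<le> 1 * L1" using L(1) m(3) by (intro mult_right_mono_neg) auto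
    finally have "real (2 * m) * ln (real n) - q * (real m * real m) \<le> L1"
      by (simp add: algebra_simps)
    then show ?thesis unfolding pow by (simp flip: exp_add)
  qed
  have t2: "real n ^ (100 * m + 1) * exp (- (q * (real n - 1 - 100 * real m))) \<le> exp L2"
  proof -
    \<comment> \<open>The constant 201 comes from \<open>100 * m + 1 \<le> 100 * a + 101\<close> and
      \<open>a \<ge> 1\<close>.\<close>
    have "real (100 * m + 1) * ln (real n) \<le> (201 * a) * ln (real n)"
      using m(2) a1 ln0 by (intro mult_right_mono) auto
    moreover have "q * (real n / 2) \<le> q * (real n - 1 - 100 * real m)"
      using half m(2) q0 by (intro mult_left_mono) auto
    ultimately have "real (100 * m + 1) * ln (real n) - q * (real n - 1 - 100 * real m)
        \<le> (201 * a) * ln (real n) - q * real n / 2" by linarith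
    also have "\<dots> = a * L2" unfolding qn L2_def by (simp add: algebra_simps)
    also have "\<dots> \<le> 1 * L2" using L(2) a1 by (intro mult_right_mono_neg) auto
    finally show ?thesis unfolding pow by (simp flip: exp_add)
  qed
  have "100 * m + 1 \<le> n" using half m(2) a1 by linarith
  with prob_not_dense_expander[OF p(1) q0 _ m(3), of n] p(2) t1 t2
  have "measure_pmf.prob (random_graph n p) {E. \<not> dense_expander {1..n} E m} \<le> exp L1 + exp L2"
    by (auto simp: q_def)
  moreover have "measure_pmf.prob (random_graph n p) {E. \<not> dense_expander {1..n} E m} =
      1 - measure_pmf.prob (random_graph n p) {E. dense_expander {1..n} E m}"
    using measure_pmf.prob_compl[of "{E. dense_expander {1..n} E m}" "random_graph n p"]
    by (simp add: Collect_neg_eq Compl_eq_Diff_UNIV)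
  ultimately show ?thesis by linarith
qed

theorem theorem1:
  fixes \<epsilon> :: real and p :: "nat \<Rightarrow> real"
  assumes "\<epsilon> > 0"
    and "\<And>n. p n \<in> {0..1}"
    and "\<And>n. n \<ge> 1 \<Longrightarrow> p n \<ge> real n powr (- 1 / 2 + \<epsilon>)"
  shows "(\<lambda>n. measure_pmf.prob (random_graph n (p n))
      {E. F2_span E {C \<in> circuits E. card C = n \<or> card C = n - 1} = cycle_space E \<and>
          (even n \<longrightarrow>
            vectorspace.dim F2
              (quotient_space (edge_space E\<lparr>carrier := cycle_space E\<rparr>)
                (F2_span E (hamilton_circuits {1..n} E))) = 1) \<and>
          (odd n \<longrightarrow> F2_span E (hamilton_circuits {1..n} E) = cycle_space E)})
    \<longlonglongrightarrow> 1"
    (is "(\<lambda>n. measure_pmf.prob _ (?S n)) \<longlonglongrightarrow> 1")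
proof -
  \<comment> \<open>The exponent \<open>1 / 2 - d / 2\<close> must not be negative, so the excess is
    capped at 1; this only weakens the lower bound on \<open>p n\<close>.\<close>
  define d where "d = min \<epsilon> 1"
  have d: "0 < d" "d \<le> 1" "d \<le> \<epsilon>" using assms(1) by (auto simp: d_def)
  define L1 L2 where "L1 = (\<lambda>n::nat. 2 * ln (real n) - real n powr (d / 2))"
    and "L2 = (\<lambda>n::nat. 201 * ln (real n) - real n powr (3 * d / 2) / 2)"
  have lim: "filterlim L1 at_bot sequentially" "filterlim L2 at_bot sequentially"
    using d(1) unfolding L1_def L2_def by real_asymp+
  have "(\<lambda>n. 1 - (exp (L1 n) + exp (L2 n))) \<longlonglongrightarrow> 1 - (0 + 0)"
    by (intro tendsto_intros filterlim_compose[OF exp_at_bot] lim)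
  then have lower: "(\<lambda>n. 1 - (exp (L1 n) + exp (L2 n))) \<longlonglongrightarrow> 1" by simp
  have "\<forall>\<^sub>F n in sequentially. 101 + 100 * real n powr (1 / 2) \<le> real n / 2"
    by real_asymp
  moreover have "\<forall>\<^sub>F n in sequentially. L1 n \<le> 0" "\<forall>\<^sub>F n in sequentially. L2 n \<le> 0"
    using lim by (auto simp: filterlim_at_bot)
  ultimately have "\<forall>\<^sub>F n in sequentially.
      1 - (exp (L1 n) + exp (L2 n)) \<le> measure_pmf.prob (random_graph n (p n)) (?S n)"
    using eventually_ge_at_top[of 1]
  proof eventually_elim
    case (elim n)
    define m where "m = nat \<lceil>real n powr (1 / 2 - d / 2)\<rceil>"
    have "real n powr (- 1 / 2 + d) \<le> real n powr (- 1 / 2 + \<epsilon>)"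
      using d(3) elim by (intro powr_mono) auto
    also have "\<dots> \<le> p n" using assms(3) elim by simp
    finally have "1 - (exp (L1 n) + exp (L2 n)) \<le>
        measure_pmf.prob (random_graph n (p n)) {E. dense_expander {1..n} E m}"
      using prob_dense_expander_ge[of d n "p n"] elim d(1,2) assms(2)
      unfolding L1_def L2_def m_def by blast
    also have "\<dots> \<le> measure_pmf.prob (random_graph n (p n)) (?S n)"
    proof (rule measure_pmf.finite_measure_mono)
      show "{E. dense_expander {1..n} E m} \<subseteq> ?S n"
        using dense_expander.hamilton_span[of "{1..n}" _ m n] elim by auto
    qed simp
    finally show ?case .
  qed
  then show ?thesis
    by (rule tendsto_sandwich[OF _ _ lower tendsto_const]) simp
qed

end
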